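(* Let $k\ge 3$ be an odd integer, let $P_k$ be the (unlabeled) path with $k$ edges and let $e$ be the (unlabeled) graph consisting of a single edge. Then $P_k$ is a trivial square. Moreover, for every $\lambda\in\mathbb{R}$, the graph combination $\lambda P_k-e^k\in\mathcal{A}_\emptyset$ is not a sum of squares (sos).
   Context: All graphs are finite and simple (no loops or multiple edges). A graph is partially labeled if some subset of its vertices (possibly empty, possibly all) carries pairwise distinct labels from $\mathbb{N}=\{1,2,3,\dots\}$, each vertex having at most one label; it is unlabeled if no vertex is labeled and fully labeled if all are. Partially labeled graphs are identified up to label-preserving isomorphism. $\mathcal{A}$ is the real vector space of formal finite $\mathbb{R}$-linear combinations ("graph combinations") of partially labeled graphs without isolated vertices, including the empty graph, denoted $1$. The product $H_1H_2$ of two partially labeled graphs is obtained by taking the disjoint union, identifying vertices carrying the same label, and keeping only one copy of any doubled edge; extended bilinearly, this makes $\mathcal{A}$ a commutative $\mathbb{R}$-algebra with identity $1$. $\mathcal{A}_\emptyset$ is the subalgebra spanned by unlabeled graphs, where the product is disjoint union (so $e^k$ is the disjoint union of $k$ edges). The linear map $[[\cdot]]:\mathcal{A}\to\mathcal{A}_\emptyset$ removes all labels. A sum of squares (sos) is an element of $\mathcal{A}_\emptyset$ of the form $\sum_i[[a_i^2]]$, a finite sum with $a_i\in\mathcal{A}$. An unlabeled graph $F$ is a trivial square if whenever $F=[[H^2]]$ for some partially labeled graph $H$, then $H$ is a fully labeled copy of $F$. *)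

theory Defs
  imports "HOL-Analysis.Finite_Function_Topology"
begin

section \<open>Partially labeled graphs\<close>

text \<open>
  Since labels are pairwise distinct, a labeled vertex is determined by its label, and we use the
  label as its name. The number in \<open>Unlabeled i\<close> has no meaning: it only tells unlabeled vertices
  of the same graph apart.
\<close>

datatype vertex = Labeled nat | Unlabeled nat

fun label_of :: "vertex \<Rightarrow> nat option" where
  "label_of (Labeled n) = Some n"
| "label_of (Unlabeled i) = None"

text \<open>
  As there are no isolated vertices, a graph is given by its set of edges \<open>E\<close>, and its
  vertex set is \<open>\<Union>E\<close>. The empty graph is \<open>{}\<close>. Labels are positive integers.
\<close>

definition pl_graph :: "vertex set set \<Rightarrow> bool" where
  "pl_graph E \<longleftrightarrow> finite E \<and> (\<forall>e\<in>E. card e = 2) \<and> (\<forall>n. Labeled n \<in> \<Union>E \<longrightarrow> n \<ge> 1)"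

definition rename :: "(vertex \<Rightarrow> vertex) \<Rightarrow> vertex set set \<Rightarrow> vertex set set" where
  "rename f E = (\<lambda>e. f ` e) ` E"

definition pl_iso :: "vertex set set \<Rightarrow> vertex set set \<Rightarrow> bool" where
  "pl_iso E F \<longleftrightarrow> pl_graph E \<and> pl_graph F \<and>
     (\<exists>f. inj_on f (\<Union>E) \<and> (\<forall>v\<in>\<Union>E. label_of (f v) = label_of v) \<and> rename f E = F)"

lemma Union_rename: "\<Union>(rename f E) = f ` \<Union>E"
  by (auto simp: rename_def)

lemma rename_comp: "rename g (rename f E) = rename (g \<circ> f) E"
  by (simp add: rename_def image_image)

lemma rename_Un: "rename f (E \<union> F) = rename f E \<union> rename f F"
  by (simp add: rename_def image_Un)

lemma rename_cong: "(\<And>v. v \<in> \<Union>E \<Longrightarrow> f v = g v) \<Longrightarrow> rename f E = rename g E"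
  unfolding rename_def by (intro image_cong refl) auto

lemma rename_ident: "(\<And>v. v \<in> \<Union>E \<Longrightarrow> f v = v) \<Longrightarrow> rename f E = E"
  using rename_cong[of E f id] by (simp add: rename_def)

lemma label_of_eq_Some: "label_of v = Some n \<longleftrightarrow> v = Labeled n"
  by (cases v) auto

lemma label_of_eq_None: "label_of v = None \<longleftrightarrow> (\<exists>i. v = Unlabeled i)"
  by (cases v) auto

lemma pl_graph_rename:
  assumes "pl_graph E" "inj_on f (\<Union>E)" "\<And>v n. v \<in> \<Union>E \<Longrightarrow> f v = Labeled n \<Longrightarrow> n \<ge> 1"
  shows "pl_graph (rename f E)"
proof -
  have "card (f ` e) = 2" if "e \<in> E" for e
    using that assms by (metis Union_upper card_image inj_on_subset pl_graph_def)
  moreover have "n \<ge> 1" if "Labeled n \<in> f ` \<Union>E" for n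
    using that assms(3) by (metis imageE)
  ultimately show ?thesis
    using assms(1) unfolding pl_graph_def Union_rename by (auto simp: rename_def)
qed

lemma pl_isoI:
  assumes "pl_graph E" "inj_on f (\<Union>E)" "\<And>v. v \<in> \<Union>E \<Longrightarrow> label_of (f v) = label_of v"
    and "rename f E = F"
  shows "pl_iso E F"
proof -
  have "pl_graph (rename f E)"
  proof (rule pl_graph_rename[OF assms(1,2)])
    fix v n assume "v \<in> \<Union>E" "f v = Labeled n"
    then have "v = Labeled n" using assms(3)[of v] by (metis label_of.simps(1) label_of_eq_Some)
    then show "n \<ge> 1" using assms(1) \<open>v \<in> \<Union>E\<close> by (auto simp: pl_graph_def)
  qed
  then show ?thesis using assms unfolding pl_iso_def by blast
qed

lemma pl_iso_refl: "pl_graph E \<Longrightarrow> pl_iso E E"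
  by (rule pl_isoI[where f = id]) (auto simp: rename_def)

lemma pl_iso_sym: assumes "pl_iso E F" shows "pl_iso F E"
proof -
  obtain f where f: "pl_graph E" "pl_graph F" "inj_on f (\<Union>E)"
      "\<forall>v\<in>\<Union>E. label_of (f v) = label_of v" "rename f E = F"
    using assms unfolding pl_iso_def by blast
  let ?g = "inv_into (\<Union>E) f"
  have U: "\<Union>F = f ` \<Union>E" using f(5) Union_rename by blast
  have g: "?g (f v) = v" if "v \<in> \<Union>E" for v using f(3) that by (rule inv_into_f_f)
  show ?thesis
  proof (rule pl_isoI[OF f(2)])
    show "inj_on ?g (\<Union>F)" unfolding U by (rule inj_on_inv_into) simp
    show "label_of (?g v) = label_of v" if "v \<in> \<Union>F" for v
      using that f(4) g unfolding U by (metis imageE)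
    show "rename ?g F = E"
      unfolding f(5)[symmetric] rename_comp by (rule rename_ident) (use g in auto)
  qed
qed

lemma pl_iso_trans: assumes "pl_iso E F" "pl_iso F G" shows "pl_iso E G"
proof -
  obtain f where f: "pl_graph E" "inj_on f (\<Union>E)"
      "\<forall>v\<in>\<Union>E. label_of (f v) = label_of v" "rename f E = F"
    using assms(1) unfolding pl_iso_def by blast
  obtain g where g: "inj_on g (\<Union>F)"
      "\<forall>v\<in>\<Union>F. label_of (g v) = label_of v" "rename g F = G"
    using assms(2) unfolding pl_iso_def by blast
  have U: "\<Union>F = f ` \<Union>E" using f(4) Union_rename by blast
  show ?thesis
  proof (rule pl_isoI[OF f(1)])
    show "inj_on (g \<circ> f) (\<Union>E)" using f(2) g(1) unfolding U by (rule comp_inj_on)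
    show "label_of ((g \<circ> f) v) = label_of v" if "v \<in> \<Union>E" for v
      using bspec[OF f(3) that] bspec[OF g(2), of "f v"] that unfolding U by simp
    show "rename (g \<circ> f) E = G" using f(4) g(3) by (simp add: rename_comp[symmetric])
  qed
qed

quotient_type plgraph = "vertex set set" / partial: pl_iso
proof (rule part_equivpI)
  show "\<exists>E. pl_iso E E" by (rule exI[of _ "{}"], rule pl_iso_refl) (simp add: pl_graph_def)
  show "symp pl_iso" by (rule sympI) (rule pl_iso_sym)
  show "transp pl_iso" by (rule transpI) (rule pl_iso_trans)
qed


section \<open>Gluing and unlabeling of graphs\<close>

fun left_vertex :: "vertex \<Rightarrow> vertex" where
  "left_vertex (Labeled n) = Labeled n"
| "left_vertex (Unlabeled i) = Unlabeled (2 * i)"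

fun right_vertex :: "vertex \<Rightarrow> vertex" where
  "right_vertex (Labeled n) = Labeled n"
| "right_vertex (Unlabeled i) = Unlabeled (2 * i + 1)"

text \<open>
  Renaming makes the unlabeled vertices of the two factors disjoint, while vertices with the same
  label have the same name and hence are identified. Doubled edges merge in the union of edge sets.
\<close>

definition glue_raw :: "vertex set set \<Rightarrow> vertex set set \<Rightarrow> vertex set set" where
  "glue_raw E F = rename left_vertex E \<union> rename right_vertex F"

lemma inj_left_vertex: "inj left_vertex"
proof (rule injI)
  fix v w show "left_vertex v = left_vertex w \<Longrightarrow> v = w" by (cases v; cases w) auto
qed

lemma inj_right_vertex: "inj right_vertex"
proof (rule injI)
  fix v w show "right_vertex v = right_vertex w \<Longrightarrow> v = w" by (cases v; cases w) auto
qed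

lemma label_of_left [simp]: "label_of (left_vertex v) = label_of v"
  by (cases v) auto

lemma label_of_right [simp]: "label_of (right_vertex v) = label_of v"
  by (cases v) auto

lemma left_eq_Labeled [simp]: "left_vertex v = Labeled n \<longleftrightarrow> v = Labeled n"
  by (cases v) auto

lemma right_eq_Labeled [simp]: "right_vertex v = Labeled n \<longleftrightarrow> v = Labeled n"
  by (cases v) auto

lemma left_eq_right: "left_vertex v = right_vertex w \<Longrightarrow> \<exists>n. v = Labeled n \<and> w = Labeled n"
  by (cases v; cases w) (auto, presburger)

lemma pl_iso_left: "pl_graph E \<Longrightarrow> pl_iso E (rename left_vertex E)"
  by (rule pl_isoI) (auto intro: inj_on_subset[OF inj_left_vertex])

lemma pl_iso_right: "pl_graph E \<Longrightarrow> pl_iso E (rename right_vertex E)"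
  by (rule pl_isoI) (auto intro: inj_on_subset[OF inj_right_vertex])

lemma pl_iso_graph: "pl_iso E F \<Longrightarrow> pl_graph E \<and> pl_graph F"
  by (simp add: pl_iso_def)

lemma pl_graph_Un: "pl_graph E \<Longrightarrow> pl_graph F \<Longrightarrow> pl_graph (E \<union> F)"
  unfolding pl_graph_def by auto

lemma pl_graph_glue: "pl_graph E \<Longrightarrow> pl_graph F \<Longrightarrow> pl_graph (glue_raw E F)"
  unfolding glue_raw_def
  by (intro pl_graph_Un pl_iso_graph[OF pl_iso_left, THEN conjunct2]
      pl_iso_graph[OF pl_iso_right, THEN conjunct2])

lemma Union_glue: "\<Union>(glue_raw E F) = left_vertex ` \<Union>E \<union> right_vertex ` \<Union>F"
  unfolding glue_raw_def by (simp add: Union_rename)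

lemma glue_raw_cong:
  assumes "pl_iso E E'" "pl_iso F F'"
  shows "pl_iso (glue_raw E F) (glue_raw E' F')"
proof -
  obtain f where f: "pl_graph E" "inj_on f (\<Union>E)"
      "\<forall>v\<in>\<Union>E. label_of (f v) = label_of v" "rename f E = E'"
    using assms(1) unfolding pl_iso_def by blast
  obtain g where g: "pl_graph F" "inj_on g (\<Union>F)"
      "\<forall>v\<in>\<Union>F. label_of (g v) = label_of v" "rename g F = F'"
    using assms(2) unfolding pl_iso_def by blast
  define h where "h v = (case v of Labeled n \<Rightarrow> Labeled n
      | Unlabeled i \<Rightarrow> if even i then left_vertex (f (Unlabeled (i div 2)))
                       else right_vertex (g (Unlabeled (i div 2))))" for v
  have hl: "h (left_vertex v) = left_vertex (f v)" if "v \<in> \<Union>E" for v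
    using f(3) that by (cases v) (auto simp: h_def label_of_eq_Some dest!: bspec[of _ _ v])
  have hr: "h (right_vertex v) = right_vertex (g v)" if "v \<in> \<Union>F" for v
    using g(3) that by (cases v) (auto simp: h_def label_of_eq_Some dest!: bspec[of _ _ v])
  have lab: "label_of (h x) = label_of x" if x: "x \<in> \<Union>(glue_raw E F)" for x
  proof -
    from x consider (l) v where "v \<in> \<Union>E" "x = left_vertex v"
      | (r) v where "v \<in> \<Union>F" "x = right_vertex v" unfolding Union_glue by blast
    then show ?thesis
    proof cases
      case l
      then show ?thesis using hl[of v] bspec[OF f(3), of v] by simp
    next
      case r
      then show ?thesis using hr[of v] bspec[OF g(3), of v] by simp
    qed
  qed
  have cross: "left_vertex v = right_vertex w"
    if vw: "v \<in> \<Union>E" "w \<in> \<Union>F" and eq: "left_vertex (f v) = right_vertex (g w)" for v w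
  proof -
    obtain n where "f v = Labeled n" "g w = Labeled n" using left_eq_right[OF eq] by blast
    then have "v = Labeled n" "w = Labeled n"
      using f(3) g(3) vw by (metis label_of_eq_Some)+
    then show ?thesis by simp
  qed
  show ?thesis
  proof (rule pl_isoI)
    show "pl_graph (glue_raw E F)" using f(1) g(1) by (rule pl_graph_glue)
    show "inj_on h (\<Union>(glue_raw E F))"
    proof (rule inj_onI)
      fix x y assume x: "x \<in> \<Union>(glue_raw E F)" and y: "y \<in> \<Union>(glue_raw E F)" and eq: "h x = h y"
      from x consider (l) v where "v \<in> \<Union>E" "x = left_vertex v"
        | (r) v where "v \<in> \<Union>F" "x = right_vertex v" unfolding Union_glue by blast
      then show "x = y"
      proof cases
        case l
        from y consider (l') w where "w \<in> \<Union>E" "y = left_vertex w"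
          | (r') w where "w \<in> \<Union>F" "y = right_vertex w" unfolding Union_glue by blast
        then show ?thesis
        proof cases
          case l'
          then have "f v = f w" using eq l hl inj_left_vertex by (metis injD)
          then show ?thesis using l l' f(2) by (metis inj_onD)
        next
          case r'
          then show ?thesis using cross[of v w] eq l hl hr by metis
        qed
      next
        case r
        from y consider (l') w where "w \<in> \<Union>E" "y = left_vertex w"
          | (r') w where "w \<in> \<Union>F" "y = right_vertex w" unfolding Union_glue by blast
        then show ?thesis
        proof cases
          case l'
          then show ?thesis using cross[of w v] eq r hl hr by metis
        next
          case r'
          then have "g v = g w" using eq r hr inj_right_vertex by (metis injD)
          then show ?thesis using r r' g(2) by (metis inj_onD)
        qed
      qed
    qed
    show "rename h (glue_raw E F) = glue_raw E' F'"
      unfolding glue_raw_def f(4)[symmetric] g(4)[symmetric] rename_Un rename_comp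
      by (intro arg_cong2[where f = "(\<union>)"] rename_cong) (auto simp: hl hr)
  qed (use lab in auto)
qed

lift_definition glue :: "plgraph \<Rightarrow> plgraph \<Rightarrow> plgraph" is glue_raw
  by (rule glue_raw_cong)

lift_definition empty_graph :: plgraph is "{}"
  by (rule pl_iso_refl) (simp add: pl_graph_def)

lemma glue_raw_commute:
  assumes "pl_graph E" "pl_graph F"
  shows "pl_iso (glue_raw E F) (glue_raw F E)"
proof -
  define s where "s i = (if even i then i + 1 else i - 1)" for i :: nat
  define h where "h v = (case v of Labeled n \<Rightarrow> Labeled n | Unlabeled i \<Rightarrow> Unlabeled (s i))" for v
  have ss: "s (s i) = i" for i by (auto simp: s_def)
  have hh: "h (h v) = v" for v by (auto simp: h_def ss split: vertex.splits)
  have "h \<circ> left_vertex = right_vertex" "h \<circ> right_vertex = left_vertex"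
  proof -
    show "h \<circ> left_vertex = right_vertex"
    proof
      fix v show "(h \<circ> left_vertex) v = right_vertex v" by (cases v) (auto simp: h_def s_def)
    qed
    show "h \<circ> right_vertex = left_vertex"
    proof
      fix v show "(h \<circ> right_vertex) v = left_vertex v" by (cases v) (auto simp: h_def s_def)
    qed
  qed
  then have "rename h (glue_raw E F) = glue_raw F E"
    unfolding glue_raw_def rename_Un rename_comp by (simp add: Un_commute)
  then show ?thesis
    by (intro pl_isoI[where f = h] pl_graph_glue assms)
       (auto intro!: inj_on_inverseI[of _ h] simp: hh, auto simp: h_def split: vertex.splits)
qed

lemma glue_raw_assoc:
  assumes "pl_graph E" "pl_graph F" "pl_graph G"
  shows "pl_iso (glue_raw (glue_raw E F) G) (glue_raw E (glue_raw F G))"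
proof -
  define s where "s i = (if 4 dvd i then i div 2 else if even i then i - 1 else 2 * i + 1)"
    for i :: nat
  define h where "h v = (case v of Labeled n \<Rightarrow> Labeled n | Unlabeled i \<Rightarrow> Unlabeled (s i))" for v
  have s1: "s (4 * i) = 2 * i" for i
    by (simp add: s_def)
  have "\<not> 4 dvd 4 * i + 2" for i :: nat by presburger
  then have s2: "s (4 * i + 2) = 4 * i + 1" for i
    unfolding s_def by simp
  have "\<not> 4 dvd 2 * i + 1" for i :: nat by presburger
  then have s3: "s (2 * i + 1) = 4 * i + 3" for i
    unfolding s_def by simp
  define t where "t j = (if even j then 2 * j else if j mod 4 = 1 then j + 1 else (j - 1) div 2)"
    for j :: nat
  have ts: "t (s i) = i" for i
  proof -
    have "(\<exists>q. i = 4 * q) \<or> (\<exists>q. i = 4 * q + 2) \<or> (\<exists>q. i = 2 * q + 1)" by presburger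
    then consider q where "i = 4 * q" | q where "i = 4 * q + 2" | q where "i = 2 * q + 1" by blast
    then show ?thesis
    proof cases
      case 1
      then show ?thesis by (simp only: s1) (simp add: t_def)
    next
      case (2 q)
      have "(4 * q + 1) mod 4 = 1" by presburger
      then show ?thesis using 2 by (simp only: s2) (simp add: t_def)
    next
      case (3 q)
      have "(4 * q + 3) mod 4 = 3" by presburger
      then show ?thesis using 3 by (simp only: s3) (simp add: t_def)
    qed
  qed
  have inj: "inj h"
  proof (rule injI)
    fix v w assume "h v = h w"
    then show "v = w"
      using ts by (cases v; cases w) (auto simp: h_def, metis)
  qed
  have h1: "h \<circ> (left_vertex \<circ> left_vertex) = left_vertex"
  proof
    fix v show "(h \<circ> (left_vertex \<circ> left_vertex)) v = left_vertex v"
      using s1 by (cases v) (auto simp: h_def)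
  qed
  have h2: "h \<circ> (left_vertex \<circ> right_vertex) = right_vertex \<circ> left_vertex"
  proof
    fix v show "(h \<circ> (left_vertex \<circ> right_vertex)) v = (right_vertex \<circ> left_vertex) v"
      using s2 by (cases v) (auto simp: h_def)
  qed
  have h3: "h \<circ> right_vertex = right_vertex \<circ> right_vertex"
  proof
    fix v show "(h \<circ> right_vertex) v = (right_vertex \<circ> right_vertex) v"
      using s3 by (cases v) (auto simp: h_def)
  qed
  have "rename h (glue_raw (glue_raw E F) G) = glue_raw E (glue_raw F G)"
    unfolding glue_raw_def rename_Un rename_comp h1 h2 h3 by (simp add: Un_assoc)
  then show ?thesis
    by (intro pl_isoI[where f = h] pl_graph_glue assms)
       (auto intro: inj_on_subset[OF inj], auto simp: h_def split: vertex.splits)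
qed

text \<open>
  \<open>Poly_Mapping\<close> takes the monoid of a monoid algebra to be written additively. So on graphs
  \<open>G + H\<close> is the product \<open>glue G H\<close>, and \<open>0\<close> is the empty graph, the identity for gluing.
\<close>

instantiation plgraph :: comm_monoid_add
begin

definition "G + H = glue G H"

definition "0 = empty_graph"

instance
proof
  fix G H K :: plgraph
  show "G + H + K = G + (H + K)"
    unfolding plus_plgraph_def
    by transfer (meson glue_raw_assoc pl_iso_graph)
  show "G + H = H + G"
    unfolding plus_plgraph_def
    by transfer (meson glue_raw_commute pl_iso_graph)
  show "0 + G = G"
    unfolding plus_plgraph_def zero_plgraph_def
  proof transfer
    fix E assume "pl_iso E E"
    then have "pl_iso E (rename right_vertex E)"
      using pl_iso_graph pl_iso_right by blast
    then show "pl_iso (glue_raw {} E) E"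
      by (simp add: glue_raw_def rename_def pl_iso_sym)
  qed
qed

end

fun unlabel_vertex :: "vertex \<Rightarrow> vertex" where
  "unlabel_vertex (Labeled n) = Unlabeled (2 * n + 1)"
| "unlabel_vertex (Unlabeled i) = Unlabeled (2 * i)"

lemma inj_unlabel_vertex: "inj unlabel_vertex"
proof (rule injI)
  fix v w show "unlabel_vertex v = unlabel_vertex w \<Longrightarrow> v = w"
    by (cases v; cases w) (auto, presburger+)
qed

lemma unlabel_neq_Labeled [simp]: "unlabel_vertex v \<noteq> Labeled n"
  by (cases v) auto

lemma label_of_unlabel [simp]: "label_of (unlabel_vertex v) = None"
  by (cases v) auto

lift_definition unlabel_graph :: "plgraph \<Rightarrow> plgraph" is "rename unlabel_vertex"
proof -
  fix E F assume "pl_iso E F"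
  then obtain f where f: "pl_graph E" "pl_graph F" "inj_on f (\<Union>E)" "rename f E = F"
    unfolding pl_iso_def by blast
  let ?u = unlabel_vertex
  let ?h = "?u \<circ> f \<circ> inv ?u"
  have h: "?h \<circ> ?u = ?u \<circ> f" by (auto simp: inj_unlabel_vertex)
  have inj: "inj_on ?h (?u ` \<Union>E)"
  proof (rule inj_onI)
    fix x y assume "x \<in> ?u ` \<Union>E" "y \<in> ?u ` \<Union>E" and eq: "?h x = ?h y"
    then obtain v w where vw: "v \<in> \<Union>E" "w \<in> \<Union>E" "x = ?u v" "y = ?u w" by blast
    then have "?u (f v) = ?u (f w)" using eq by (simp add: inj_unlabel_vertex)
    then have "f v = f w" using inj_unlabel_vertex by (rule injD[rotated])
    then have "v = w" using inj_onD[OF f(3)] vw by blast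
    then show "x = y" using vw by simp
  qed
  show "pl_iso (rename ?u E) (rename ?u F)"
  proof (rule pl_isoI[where f = ?h])
    show "pl_graph (rename ?u E)"
      by (rule pl_graph_rename[OF f(1)])
         (simp_all add: inj_on_subset[OF inj_unlabel_vertex])
    show "inj_on ?h (\<Union>(rename ?u E))" using inj by (simp add: Union_rename)
    show "label_of (?h v) = label_of v" if "v \<in> \<Union>(rename ?u E)" for v
      using that unfolding Union_rename by auto
    show "rename ?h (rename ?u E) = rename ?u F"
      unfolding rename_comp h f(4)[symmetric] ..
  qed
qed

lift_definition fully_labeled :: "plgraph \<Rightarrow> bool" is
  "\<lambda>E. \<forall>v\<in>\<Union>E. label_of v \<noteq> None"
  unfolding pl_iso_def rename_def by auto

lift_definition unlabeled :: "plgraph \<Rightarrow> bool" is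
  "\<lambda>E. \<forall>v\<in>\<Union>E. label_of v = None"
  unfolding pl_iso_def rename_def by auto

text \<open>\<open>unlabel_graph H = F\<close> says that \<open>H\<close> is a copy of \<open>F\<close> up to labels.\<close>

definition trivial_square :: "plgraph \<Rightarrow> bool" where
  "trivial_square F \<longleftrightarrow> unlabeled F \<and>
     (\<forall>H. F = unlabel_graph (glue H H) \<longrightarrow> fully_labeled H \<and> unlabel_graph H = F)"

lift_definition edge_graph :: plgraph is "{{Unlabeled 0, Unlabeled 1}}"
  by (rule pl_iso_refl) (auto simp: pl_graph_def)

lift_definition path_graph :: "nat \<Rightarrow> plgraph" is
  "\<lambda>k. (\<lambda>i. {Unlabeled i, Unlabeled (i + 1)}) ` {..<k}"
  by (rule pl_iso_refl) (auto simp: pl_graph_def)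


section \<open>The algebra of graph combinations\<close>

text \<open>Multiplication and powers of graph combinations are those of the monoid algebra.\<close>

type_synonym graph_combination = "plgraph \<Rightarrow>\<^sub>0 real"

definition of_graph :: "plgraph \<Rightarrow> graph_combination" where
  "of_graph G = Poly_Mapping.single G 1"

definition unlabeled_algebra :: "graph_combination set" where
  "unlabeled_algebra = span (of_graph ` {G. unlabeled G})"

definition unlabel :: "graph_combination \<Rightarrow> graph_combination" where
  "unlabel a = (\<Sum>G\<in>Poly_Mapping.keys a. Poly_Mapping.lookup a G *\<^sub>R of_graph (unlabel_graph G))"

definition sos :: "graph_combination \<Rightarrow> bool" where
  "sos x \<longleftrightarrow> x \<in> unlabeled_algebra \<and> (\<exists>as. x = (\<Sum>a\<leftarrow>as. unlabel (a\<^sup>2)))"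

lemma of_graph_glue: "of_graph (glue G H) = of_graph G * of_graph H"
  by (simp add: of_graph_def mult_single plus_plgraph_def)

lemma of_graph_empty: "of_graph empty_graph = 1"
  by (simp add: of_graph_def zero_plgraph_def[symmetric])

lemma lookup_scaleR_graph:
  "Poly_Mapping.lookup (c *\<^sub>R (a :: graph_combination)) G = c * Poly_Mapping.lookup a G"
proof -
  have "finite {i. c *\<^sub>R Poly_Mapping.lookup a i \<noteq> 0}"
    by (rule finite_subset[OF _ finite_keys[of a]]) (auto simp: in_keys_iff)
  then show ?thesis
    by (simp add: scaleR_poly_mapping_def Abs_poly_mapping_inverse)
qed

lemma unlabel_superset:
  assumes "finite S" "Poly_Mapping.keys a \<subseteq> S"
  shows "unlabel a = (\<Sum>G\<in>S. Poly_Mapping.lookup a G *\<^sub>R of_graph (unlabel_graph G))"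
  unfolding unlabel_def using assms by (intro sum.mono_neutral_left) (auto simp: in_keys_iff)

lemma linear_unlabel: "linear unlabel"
proof (rule linearI)
  fix a b :: graph_combination and c :: real
  let ?S = "Poly_Mapping.keys a \<union> Poly_Mapping.keys b"
  have "finite ?S" by simp
  moreover have "Poly_Mapping.keys (a + b) \<subseteq> ?S" by (rule keys_add)
  ultimately show "unlabel (a + b) = unlabel a + unlabel b"
    by (simp add: unlabel_superset[of ?S] lookup_add scaleR_add_left sum.distrib)
  have "Poly_Mapping.keys (c *\<^sub>R a) \<subseteq> Poly_Mapping.keys a"
    by (auto simp: in_keys_iff lookup_scaleR_graph)
  then show "unlabel (c *\<^sub>R a) = c *\<^sub>R unlabel a"
    by (simp add: unlabel_superset[of "Poly_Mapping.keys a"] lookup_scaleR_graph scaleR_sum_right)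
qed

lemma unlabel_of_graph: "unlabel (of_graph G) = of_graph (unlabel_graph G)"
  by (simp add: unlabel_def of_graph_def)

lemma unlabeled_unlabel_graph: "unlabeled (unlabel_graph G)"
  by transfer (auto simp: Union_rename)

lemma unlabeled_path_graph: "unlabeled (path_graph k)"
  by transfer auto

lemma unlabeled_edge_graph: "unlabeled edge_graph"
  by transfer auto

lemma unlabel_in_unlabeled_algebra: "unlabel a \<in> unlabeled_algebra"
  unfolding unlabel_def unlabeled_algebra_def
  by (intro span_sum span_scale span_base) (auto simp: unlabeled_unlabel_graph)

lemma sum_unlabel_in_unlabeled_algebra: "(\<Sum>a\<leftarrow>as. unlabel (f a)) \<in> unlabeled_algebra"
  using unlabel_in_unlabeled_algebra unfolding unlabeled_algebra_def
  by (induction as) (auto intro: span_add span_zero)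

lemma unlabeled_glue: "unlabeled G \<Longrightarrow> unlabeled H \<Longrightarrow> unlabeled (glue G H)"
  by transfer (auto simp: Union_glue simp del: Union_iff)

lemma edge_power_in_unlabeled_algebra: "of_graph edge_graph ^ k \<in> unlabeled_algebra"
proof -
  have "\<exists>G. unlabeled G \<and> of_graph edge_graph ^ k = of_graph G"
  proof (induction k)
    case 0
    have "unlabeled empty_graph" by transfer simp
    then show ?case using of_graph_empty by auto
  next
    case (Suc k)
    then show ?case
      by (metis of_graph_glue power_Suc unlabeled_edge_graph unlabeled_glue)
  qed
  then show ?thesis unfolding unlabeled_algebra_def by (auto intro: span_base)
qed

lemma path_edge_in_unlabeled_algebra:
  "c *\<^sub>R of_graph (path_graph k) - of_graph edge_graph ^ k \<in> unlabeled_algebra"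
proof -
  have "of_graph (path_graph k) \<in> unlabeled_algebra"
    unfolding unlabeled_algebra_def by (rule span_base) (simp add: unlabeled_path_graph)
  then show ?thesis
    using edge_power_in_unlabeled_algebra
    unfolding unlabeled_algebra_def by (intro span_diff span_scale)
qed

end

theory Submission
  imports Defs
begin

text \<open>
  The coefficients of squares are compared by means of a real weight \<open>w\<close> on graphs that is strictly midpoint convex on products: \<open>2 w(XY) < w(XX) + w(YY)\<close> for
  \<open>X \<noteq> Y\<close>. Such a \<open>w\<close> is obtained by summing homomorphism densities over all targets on a large
  finite vertex set, as the defect is then a sum of squares that separates the partially labeled
  graphs at hand. The number of edges is midpoint convex in the opposite direction.

  Let \<open>F\<close> be a trivial square and suppose that \<open>c F - G\<close> is a sum of squares, where \<open>G \<noteq> F\<close> has as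
  many edges as \<open>F\<close>. Among the occurring graphs \<open>X\<close> with \<open>[[XX]] \<noteq> F\<close>, take those whose square has
  the fewest edges and, among these, maximal weight. No product of two distinct occurring graphs
  contributes to graphs other than \<open>F\<close> with this number of edges and this weight; triviality of \<open>F\<close>
  excludes cross terms with the fully labeled copies of \<open>F\<close>. So the coefficients of these graphs have
  a positive sum, whereas \<open>F\<close> is the only graph that can have a positive coefficient in \<open>c F - G\<close>.

  If the square of \<open>H\<close> is an odd path, counting edges gives a fully labeled edge in \<open>H\<close>. The labels
  propagate along the path, because an unlabeled neighbour of a labeled vertex is doubled in the
  square and would give that vertex a third neighbour.
\<close>

section \<open>Numbers of edges and vertices\<close>

lemma finite_Union_pl_graph: "pl_graph E \<Longrightarrow> finite (\<Union>E)"
  unfolding pl_graph_def by (metis card.infinite finite_Union zero_neq_numeral)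

lemma pl_graph_finite: "pl_graph E \<Longrightarrow> finite E"
  by (simp add: pl_graph_def)

lemma card_rename: "inj_on f (\<Union>E) \<Longrightarrow> card (rename f E) = card E"
  unfolding rename_def by (rule card_image) (rule inj_on_image)

lift_definition nedges :: "plgraph \<Rightarrow> nat" is card
  by (auto simp: pl_iso_def card_rename)

lift_definition nverts :: "plgraph \<Rightarrow> nat" is "\<lambda>E. card (\<Union>E)"
  by (auto simp: pl_iso_def Union_rename card_image simp del: Union_iff)

lemma nedges_unlabel [simp]: "nedges (unlabel_graph X) = nedges X"
  by transfer (rule card_rename, rule inj_on_subset[OF inj_unlabel_vertex], simp)

section \<open>Doubled edges and the number of edges of a product\<close>

definition labeled_edges :: "vertex set set \<Rightarrow> vertex set set" where
  "labeled_edges E = {e\<in>E. \<forall>v\<in>e. label_of v \<noteq> None}"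

lemma left_labeled [simp]: "label_of v \<noteq> None \<Longrightarrow> left_vertex v = v"
  by (cases v) auto

lemma right_labeled [simp]: "label_of v \<noteq> None \<Longrightarrow> right_vertex v = v"
  by (cases v) auto

lemma left_eq_right_iff: "left_vertex v = right_vertex w \<longleftrightarrow> v = w \<and> label_of v \<noteq> None"
  using left_eq_right[of v w] left_labeled right_labeled by (metis label_of.simps(1) option.distinct(1))

text \<open>The two renamings agree only on equal labeled vertices, and they fix these. So an edge
  doubled by gluing has both ends labeled and occurs unchanged in both factors.\<close>

lemma left_Int_right: "rename left_vertex E \<inter> rename right_vertex F = labeled_edges E \<inter> labeled_edges F"
proof (intro set_eqI iffI)
  fix x assume "x \<in> rename left_vertex E \<inter> rename right_vertex F"
  then obtain e f where ef: "e \<in> E" "f \<in> F" "x = left_vertex ` e" "x = right_vertex ` f"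
    by (auto simp: rename_def)
  have 1: "v \<in> f \<and> label_of v \<noteq> None" if "v \<in> e" for v
  proof -
    have "left_vertex v \<in> right_vertex ` f" using that ef by blast
    then show ?thesis by (auto simp: left_eq_right_iff)
  qed
  have 2: "v \<in> e" if "v \<in> f" for v
  proof -
    have "right_vertex v \<in> left_vertex ` e" using that ef by blast
    then show ?thesis using left_eq_right_iff by (metis imageE)
  qed
  have "e = f" using 1 2 by blast
  moreover have "x = e" using ef(3) 1 left_labeled by force
  ultimately show "x \<in> labeled_edges E \<inter> labeled_edges F"
    using ef 1 by (auto simp: labeled_edges_def)
next
  fix x assume x: "x \<in> labeled_edges E \<inter> labeled_edges F"
  then have "left_vertex ` x = x" "right_vertex ` x = x"
    unfolding labeled_edges_def using left_labeled right_labeled by force+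
  then show "x \<in> rename left_vertex E \<inter> rename right_vertex F"
    using x unfolding labeled_edges_def rename_def by blast
qed

lemma card_glue_raw:
  assumes "finite E" "finite F"
  shows "card (glue_raw E F) + card (labeled_edges E \<inter> labeled_edges F) = card E + card F"
proof -
  have "card (rename left_vertex E) = card E" "card (rename right_vertex F) = card F"
    by (auto intro!: card_rename inj_on_subset[OF inj_left_vertex] inj_on_subset[OF inj_right_vertex])
  moreover have "finite (rename left_vertex E)" "finite (rename right_vertex F)"
    using assms by (simp_all add: rename_def)
  ultimately show ?thesis
    using card_Un_Int unfolding glue_raw_def left_Int_right[symmetric] by metis
qed

text \<open>By inclusion-exclusion, squaring loses all fully labeled edges of a factor, while a
  mixed product loses only the common ones. The latter number is at most the mean of the former
  two.\<close>

lemma nedges_glue_midpoint: "nedges (glue X X) + nedges (glue Y Y) \<le> 2 * nedges (glue X Y)"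
proof transfer
  fix E F assume "pl_iso E E" "pl_iso F F"
  then have fin: "finite E" "finite F" by (auto dest: pl_iso_graph simp: pl_graph_finite)
  then have "finite (labeled_edges E)" "finite (labeled_edges F)" by (auto simp: labeled_edges_def)
  then have "card (labeled_edges E \<inter> labeled_edges F) \<le> card (labeled_edges E)"
    "card (labeled_edges E \<inter> labeled_edges F) \<le> card (labeled_edges F)" by (auto intro: card_mono)
  then show "card (glue_raw E E) + card (glue_raw F F) \<le> 2 * card (glue_raw E F)"
    using card_glue_raw[OF fin] card_glue_raw[OF fin(1) fin(1)] card_glue_raw[OF fin(2) fin(2)] by simp
qed

lemma nedges_le_glue: "nedges X \<le> nedges (glue X Y)"
proof transfer
  fix E F assume "pl_iso E E" "pl_iso F F"
  then have fin: "finite E" "finite F" by (auto dest: pl_iso_graph simp: pl_graph_finite)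
  then have "card (labeled_edges E \<inter> labeled_edges F) \<le> card F"
    by (intro card_mono) (auto simp: labeled_edges_def)
  then show "card E \<le> card (glue_raw E F)"
    using card_glue_raw[OF fin] by simp
qed

lemma rename_fully_labeled:
  assumes "\<forall>v\<in>\<Union>E. label_of v \<noteq> None"
  shows "rename left_vertex E = E" "rename right_vertex E = E"
  using assms by (auto intro!: rename_ident)

lemma glue_self_fully_labeled: "fully_labeled X \<Longrightarrow> glue X X = X"
  by transfer (simp add: glue_raw_def rename_fully_labeled)

text \<open>A fully labeled \<open>X\<close> sits unchanged inside the product, so the edge bound
  leaves no room for a new edge. Hence \<open>Y\<close> is a fully labeled subgraph of
  \<open>X\<close>, its square is \<open>Y\<close> itself, and the second bound forces equality.
  This rigidity later excludes cross terms with copies of \<open>F\<close>.\<close>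

lemma eq_of_nedges_glue_le:
  assumes "fully_labeled X" "nedges (glue X Y) \<le> nedges X" "nedges X \<le> nedges (glue Y Y)"
  shows "Y = X"
  using assms
proof transfer
  fix E F assume iso: "pl_iso E E" "pl_iso F F" and lab: "\<forall>v\<in>\<Union>E. label_of v \<noteq> None"
    and le: "card (glue_raw E F) \<le> card E" "card E \<le> card (glue_raw F F)"
  have fin: "finite E" "finite F" using iso by (auto dest: pl_iso_graph simp: pl_graph_finite)
  have glue: "glue_raw E F = E \<union> rename right_vertex F"
    using lab by (simp add: glue_raw_def rename_fully_labeled)
  then have "E = glue_raw E F"
    using le(1) fin by (intro card_seteq) (auto simp: rename_def)
  then have sub: "rename right_vertex F \<subseteq> E" using glue by blast
  have labF: "\<forall>v\<in>\<Union>F. label_of v \<noteq> None"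
  proof
    fix v assume "v \<in> \<Union>F"
    then have "right_vertex v \<in> \<Union>(rename right_vertex F)" by (auto simp: Union_rename)
    then have "right_vertex v \<in> \<Union>E" using sub by blast
    then show "label_of v \<noteq> None" using lab label_of_right by metis
  qed
  then have "glue_raw F F = F" "F \<subseteq> E" using sub by (auto simp: glue_raw_def rename_fully_labeled)
  then have "F = E" using le fin by (metis card_seteq)
  then show "pl_iso F E" using iso by simp
qed

section \<open>A strictly midpoint convex weight\<close>

text \<open>The domain \<open>V\<close> may exceed \<open>\<Union>E\<close>, so that different
  graphs can be compared on one common vertex set.\<close>

definition hom_set :: "vertex set \<Rightarrow> vertex set \<Rightarrow> vertex set set \<Rightarrow> vertex set set \<Rightarrow> (vertex \<Rightarrow> vertex) set" where
  "hom_set A V E T = {\<psi> \<in> V \<rightarrow>\<^sub>E A. rename \<psi> E \<subseteq> T}"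

lemma card_hom_set_rename:
  assumes "inj_on f V" "\<Union>E \<subseteq> V"
  shows "card (hom_set A (f ` V) (rename f E) T) = card (hom_set A V E T)"
proof (rule bij_betw_same_card)
  let ?r = "\<lambda>\<psi>. restrict (\<psi> \<circ> f) V" and ?s = "\<lambda>\<chi>. restrict (\<chi> \<circ> inv_into V f) (f ` V)"
  have ren: "rename (?r \<psi>) E = rename \<psi> (rename f E)" for \<psi>
    unfolding rename_comp using assms(2) by (intro rename_cong) auto
  have ren': "rename (?s \<chi>) (rename f E) = rename \<chi> E" for \<chi>
    unfolding rename_comp using assms by (intro rename_cong) (auto simp: inv_into_f_f subset_iff)
  show "bij_betw ?r (hom_set A (f ` V) (rename f E) T) (hom_set A V E T)"
  proof (rule bij_betw_byWitness[where f' = ?s])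
    show "\<forall>a\<in>hom_set A (f ` V) (rename f E) T. ?s (?r a) = a"
      using assms(1) by (auto simp: hom_set_def fun_eq_iff inv_into_f_f PiE_def extensional_def)
    show "\<forall>a\<in>hom_set A V E T. ?r (?s a) = a"
      using assms(1) by (auto simp: hom_set_def fun_eq_iff inv_into_f_f PiE_def extensional_def)
    show "?r ` hom_set A (f ` V) (rename f E) T \<subseteq> hom_set A V E T"
      unfolding hom_set_def using ren by (auto simp: PiE_def Pi_def)
    show "?s ` hom_set A V E T \<subseteq> hom_set A (f ` V) (rename f E) T"
      unfolding hom_set_def using ren' assms(1) by (auto simp: PiE_def Pi_def inv_into_f_f)
  qed
qed

text \<open>A vertex on no edge can be mapped anywhere, which contributes a factor
  \<open>card A\<close>. Therefore densities do not depend on the surrounding vertex set.\<close>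

lemma card_hom_set_extend:
  assumes "finite D" "D \<inter> W = {}" "\<Union>E \<subseteq> W"
  shows "card (hom_set A (W \<union> D) E T) = card (hom_set A W E T) * card A ^ card D"
  using assms(1,2)
proof (induction D)
  case (insert x D)
  let ?u = "\<lambda>(y, g). g(x := y)"
  have x: "x \<notin> W \<union> D" "x \<notin> \<Union>E" using insert assms(3) by auto
  have ren: "rename (g(x := y)) E = rename g E" for g :: "vertex \<Rightarrow> vertex" and y
    using x(2) by (intro rename_cong) auto
  have "hom_set A (insert x (W \<union> D)) E T = ?u ` (A \<times> hom_set A (W \<union> D) E T)"
    unfolding hom_set_def PiE_insert_eq by (force simp: ren)
  moreover have "inj_on ?u (A \<times> hom_set A (W \<union> D) E T)"
  proof (rule inj_onI, clarify)
    fix y g y' g' assume g: "g \<in> hom_set A (W \<union> D) E T" "g' \<in> hom_set A (W \<union> D) E T"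
      and eq: "g(x := y) = g'(x := y')"
    have "g x = undefined" "g' x = undefined" using g x(1) by (auto simp: hom_set_def)
    then show "y = y' \<and> g = g'"
      using eq by (metis fun_upd_same fun_upd_triv fun_upd_upd)
  qed
  ultimately have "card (hom_set A (insert x (W \<union> D)) E T) = card A * card (hom_set A (W \<union> D) E T)"
    by (simp add: card_image card_cartesian_product)
  then show ?case using insert by simp
qed simp

text \<open>
  Targets \<open>T\<close> are arbitrary sets of subsets of \<open>A\<close>; no restriction to graphs is needed.
\<close>

lift_definition hom_weight :: "vertex set \<Rightarrow> plgraph \<Rightarrow> real" is
  "\<lambda>A E. (\<Sum>T\<in>Pow (Pow A). real (card (hom_set A (\<Union>E) E T)) / real (card A) ^ card (\<Union>E))"
  by (auto simp: pl_iso_def Union_rename card_image card_hom_set_rename simp del: Union_iff)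

lemma hom_weight_unlabel [simp]: "hom_weight A (unlabel_graph X) = hom_weight A X"
proof transfer
  fix A E
  have "inj_on unlabel_vertex (\<Union>E)" by (rule inj_on_subset[OF inj_unlabel_vertex]) simp
  then show "(\<Sum>T\<in>Pow (Pow A). real (card (hom_set A (\<Union>(rename unlabel_vertex E)) (rename unlabel_vertex E) T)) /
        real (card A) ^ card (\<Union>(rename unlabel_vertex E)))
     = (\<Sum>T\<in>Pow (Pow A). real (card (hom_set A (\<Union>E) E T)) / real (card A) ^ card (\<Union>E))"
    by (simp add: Union_rename card_image card_hom_set_rename del: Union_iff)
qed

section \<open>Homomorphism counts of products, with the images of labeled vertices
  prescribed\<close>

definition labeled_part :: "vertex set \<Rightarrow> vertex set" where
  "labeled_part V = {v\<in>V. label_of v \<noteq> None}"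

definition hom_fiber where
  "hom_fiber A V E T \<phi> = {\<psi> \<in> hom_set A V E T. restrict \<psi> (labeled_part V) = \<phi>}"

lemma finite_hom_fiber: "finite V \<Longrightarrow> finite A \<Longrightarrow> finite (hom_fiber A V E T \<phi>)"
  by (rule finite_subset[of _ "V \<rightarrow>\<^sub>E A"]) (auto simp: hom_fiber_def hom_set_def finite_PiE)

text \<open>The two copies of \<open>V\<close> meet exactly in its labeled vertices. Once the images
  of these are fixed as \<open>\<phi>\<close>, maps on the two copies can be chosen independently.
  This turns the count into an inner product of vectors indexed by \<open>\<phi>\<close>.\<close>

lemma card_hom_set_glue:
  assumes "finite V" "finite A" "\<Union>E \<subseteq> V" "\<Union>F \<subseteq> V"
  shows "card (hom_set A (left_vertex ` V \<union> right_vertex ` V) (glue_raw E F) T) =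
    (\<Sum>\<phi>\<in>labeled_part V \<rightarrow>\<^sub>E A. card (hom_fiber A V E T \<phi>) * card (hom_fiber A V F T \<phi>))"
proof -
  let ?W = "left_vertex ` V \<union> right_vertex ` V" and ?P = "labeled_part V \<rightarrow>\<^sub>E A"
  let ?S = "SIGMA \<phi>:?P. hom_fiber A V E T \<phi> \<times> hom_fiber A V F T \<phi>"
  let ?f = "\<lambda>\<psi>. (restrict \<psi> (labeled_part V), restrict (\<psi> \<circ> left_vertex) V, restrict (\<psi> \<circ> right_vertex) V)"
  let ?g = "\<lambda>(\<phi>, a, b). restrict (\<lambda>v. if v \<in> left_vertex ` V then a (inv left_vertex v) else b (inv right_vertex v)) ?W"
  have L: "restrict (\<psi> \<circ> left_vertex) V \<in> hom_fiber A V E T (restrict \<psi> (labeled_part V))"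
    and R: "restrict (\<psi> \<circ> right_vertex) V \<in> hom_fiber A V F T (restrict \<psi> (labeled_part V))"
    and Q: "restrict \<psi> (labeled_part V) \<in> ?P"
    if psi: "\<psi> \<in> hom_set A ?W (glue_raw E F) T" for \<psi>
  proof -
    have "rename (restrict (\<psi> \<circ> left_vertex) V) E = rename \<psi> (rename left_vertex E)"
      unfolding rename_comp using assms(3) by (intro rename_cong) auto
    then show "restrict (\<psi> \<circ> left_vertex) V \<in> hom_fiber A V E T (restrict \<psi> (labeled_part V))"
      using psi unfolding hom_fiber_def hom_set_def glue_raw_def rename_Un
      by (auto simp: labeled_part_def fun_eq_iff)
    have "rename (restrict (\<psi> \<circ> right_vertex) V) F = rename \<psi> (rename right_vertex F)"
      unfolding rename_comp using assms(4) by (intro rename_cong) auto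
    then show "restrict (\<psi> \<circ> right_vertex) V \<in> hom_fiber A V F T (restrict \<psi> (labeled_part V))"
      using psi unfolding hom_fiber_def hom_set_def glue_raw_def rename_Un
      by (auto simp: labeled_part_def fun_eq_iff)
    have "v \<in> left_vertex ` V" if "v \<in> labeled_part V" for v
      using that left_labeled[of v] unfolding labeled_part_def by force
    then show "restrict \<psi> (labeled_part V) \<in> ?P"
      using psi unfolding hom_set_def by auto
  qed
  have gl: "?g (\<phi>, a, b) (left_vertex v) = a v" if "v \<in> V" for \<phi> a b :: "vertex \<Rightarrow> vertex" and v
    using that by (simp add: inj_left_vertex)
  \<comment> \<open>On shared vertices \<open>?g\<close> takes its value from \<open>a\<close>. This
    agrees with \<open>b\<close>, since both restrict to \<open>\<phi>\<close> on labeled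
    vertices.\<close>
  have gr: "?g (\<phi>, a, b) (right_vertex v) = b v"
    if v: "v \<in> V" and ab: "a \<in> hom_fiber A V E T \<phi>" "b \<in> hom_fiber A V F T \<phi>" for \<phi> a b v
  proof (cases "right_vertex v \<in> left_vertex ` V")
    case True
    then obtain u where "u \<in> V" "right_vertex v = left_vertex u" by blast
    then have u: "right_vertex v = left_vertex v" "label_of v \<noteq> None"
      using left_eq_right_iff by metis+
    have "v \<in> labeled_part V" using u v by (simp add: labeled_part_def)
    then have "a v = b v" using ab unfolding hom_fiber_def by (metis (mono_tags, lifting) mem_Collect_eq restrict_apply')
    then show ?thesis by (simp only: u(1) gl[OF v])
  next
    case False
    then show ?thesis using v by (simp add: inj_right_vertex)
  qed
  have mem: "?g (\<phi>, a, b) \<in> hom_set A ?W (glue_raw E F) T"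
    if ab: "a \<in> hom_fiber A V E T \<phi>" "b \<in> hom_fiber A V F T \<phi>" for \<phi> a b
  proof -
    have "rename (?g (\<phi>, a, b)) (rename left_vertex E) = rename a E"
      unfolding rename_comp using assms(3) gl by (intro rename_cong) (auto simp del: restrict_apply)
    moreover have "rename (?g (\<phi>, a, b)) (rename right_vertex F) = rename b F"
      unfolding rename_comp using assms(4) gr[OF _ ab] by (intro rename_cong) (auto simp del: restrict_apply)
    moreover have "?g (\<phi>, a, b) \<in> ?W \<rightarrow>\<^sub>E A"
    proof (rule PiE_I)
      fix x assume "x \<in> ?W"
      then show "?g (\<phi>, a, b) x \<in> A"
      proof
        assume "x \<in> left_vertex ` V"
        then obtain v where v: "v \<in> V" "x = left_vertex v" by blast
        have "a v \<in> A" using ab(1) v(1) unfolding hom_fiber_def hom_set_def by auto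
        then show ?thesis unfolding v(2) gl[OF v(1)] .
      next
        assume "x \<in> right_vertex ` V"
        then obtain v where v: "v \<in> V" "x = right_vertex v" by blast
        have "b v \<in> A" using ab(2) v(1) unfolding hom_fiber_def hom_set_def by auto
        then show ?thesis unfolding v(2) gr[OF v(1) ab] .
      qed
    qed auto
    moreover have "rename a E \<subseteq> T" "rename b F \<subseteq> T"
      using ab unfolding hom_fiber_def hom_set_def by blast+
    ultimately show ?thesis
      unfolding hom_set_def glue_raw_def rename_Un mem_Collect_eq by (simp only: Un_subset_iff)
  qed
  have "bij_betw ?f (hom_set A ?W (glue_raw E F) T) ?S"
  proof (rule bij_betw_byWitness[where f' = ?g])
    show "\<forall>\<psi>\<in>hom_set A ?W (glue_raw E F) T. ?g (?f \<psi>) = \<psi>"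
    proof
      fix \<psi> assume psi: "\<psi> \<in> hom_set A ?W (glue_raw E F) T"
      show "?g (?f \<psi>) = \<psi>"
      proof
        fix x
        consider v where "v \<in> V" "x = left_vertex v" | v where "v \<in> V" "x = right_vertex v" | "x \<notin> ?W"
          by blast
        then show "?g (?f \<psi>) x = \<psi> x"
        proof cases
          case 1
          show ?thesis unfolding 1(2) by (rule trans[OF gl[OF 1(1)]]) (simp add: 1(1))
        next
          case 2
          show ?thesis unfolding 2(2)
            by (rule trans[OF gr[OF 2(1) L[OF psi] R[OF psi]]]) (simp add: 2(1))
        next
          case 3
          then have "\<psi> x = undefined" using psi unfolding hom_set_def by blast
          then show ?thesis using 3 by (simp only: prod.case restrict_apply if_False)
        qed
      qed
    qed
    show "\<forall>t\<in>?S. ?f (?g t) = t"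
    proof
      fix t assume "t \<in> ?S"
      then obtain \<phi> a b where t: "t = (\<phi>, a, b)"
        and ab: "a \<in> hom_fiber A V E T \<phi>" "b \<in> hom_fiber A V F T \<phi>" by blast
      have "restrict (?g (\<phi>, a, b) \<circ> left_vertex) V = a"
      proof
        fix v
        have "a v = undefined" if "v \<notin> V" using ab(1) that unfolding hom_fiber_def hom_set_def by blast
        then show "restrict (?g (\<phi>, a, b) \<circ> left_vertex) V v = a v"
        proof (cases "v \<in> V")
          case True
          show ?thesis unfolding restrict_apply'[OF True] comp_apply by (rule gl[OF True])
        qed (simp only: restrict_apply if_False not_False_eq_True)
      qed
      moreover have "restrict (?g (\<phi>, a, b) \<circ> right_vertex) V = b"
      proof
        fix v
        have "b v = undefined" if "v \<notin> V" using ab(2) that unfolding hom_fiber_def hom_set_def by blast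
        then show "restrict (?g (\<phi>, a, b) \<circ> right_vertex) V v = b v"
        proof (cases "v \<in> V")
          case True
          show ?thesis unfolding restrict_apply'[OF True] comp_apply by (rule gr[OF True ab])
        qed (simp only: restrict_apply if_False not_False_eq_True)
      qed
      moreover have "restrict (?g (\<phi>, a, b)) (labeled_part V) = \<phi>"
        using L[OF mem[OF ab]] ab(1) calculation(1) by (simp only: hom_fiber_def mem_Collect_eq)
      ultimately show "?f (?g t) = t" unfolding t by (simp only:)
    qed
    show "?f ` hom_set A ?W (glue_raw E F) T \<subseteq> ?S"
      by (intro image_subsetI SigmaI L R Q)
    show "?g ` ?S \<subseteq> hom_set A ?W (glue_raw E F) T"
    proof (rule image_subsetI)
      fix t assume "t \<in> ?S"
      then obtain \<phi> a b where t: "t = (\<phi>, a, b)"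
        and ab: "a \<in> hom_fiber A V E T \<phi>" "b \<in> hom_fiber A V F T \<phi>" by blast
      show "?g t \<in> hom_set A ?W (glue_raw E F) T" unfolding t by (rule mem[OF ab])
    qed
  qed
  then have "card (hom_set A ?W (glue_raw E F) T) = card ?S" by (rule bij_betw_same_card)
  also have "\<dots> = (\<Sum>\<phi>\<in>?P. card (hom_fiber A V E T \<phi>) * card (hom_fiber A V F T \<phi>))"
  proof -
    have "finite ?P" using assms by (auto intro!: finite_PiE simp: labeled_part_def)
    then show ?thesis using assms by (simp add: card_cartesian_product finite_hom_fiber)
  qed
  finally show ?thesis .
qed

text \<open>Passing to the common set \<open>V\<close> gives all products the same denominator and
  the same index set for the inner product, so weights of \<open>XX\<close>, \<open>XY\<close> and
  \<open>YY\<close> can be combined termwise.\<close>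

lemma hom_weight_abs_glue:
  assumes V: "finite V" and A: "finite A" "A \<noteq> {}"
    and E: "pl_graph E" "\<Union>E \<subseteq> V" and F: "pl_graph F" "\<Union>F \<subseteq> V"
  shows "hom_weight A (glue (abs_plgraph E) (abs_plgraph F)) =
    (\<Sum>T\<in>Pow (Pow A). \<Sum>\<phi>\<in>labeled_part V \<rightarrow>\<^sub>E A.
       real (card (hom_fiber A V E T \<phi>)) * real (card (hom_fiber A V F T \<phi>)))
    / real (card A) ^ card (left_vertex ` V \<union> right_vertex ` V)"
proof -
  let ?W = "left_vertex ` V \<union> right_vertex ` V" and ?G = "glue_raw E F"
  have finW: "finite ?W" using V by simp
  have sub: "\<Union>?G \<subseteq> ?W" using E(2) F(2) unfolding Union_glue by blast
  have c: "real (card A) \<noteq> 0" using A by simp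
  \<comment> \<open>The vertices of \<open>?W\<close> outside the product are free, and their factor
    cancels against the larger power in the denominator.\<close>
  have norm: "real (card (hom_set A (\<Union>?G) ?G T)) / real (card A) ^ card (\<Union>?G)
    = real (card (hom_set A ?W ?G T)) / real (card A) ^ card ?W" for T
  proof -
    have "card (hom_set A (\<Union>?G \<union> (?W - \<Union>?G)) ?G T)
        = card (hom_set A (\<Union>?G) ?G T) * card A ^ card (?W - \<Union>?G)"
      by (rule card_hom_set_extend) (use finW in auto)
    then have "card (hom_set A ?W ?G T) = card (hom_set A (\<Union>?G) ?G T) * card A ^ card (?W - \<Union>?G)"
      by (simp only: Diff_partition[OF sub])
    moreover have "card ?W = card (\<Union>?G) + card (?W - \<Union>?G)"
      using card_Diff_subset[OF finite_subset[OF sub finW] sub] card_mono[OF finW sub] by linarith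
    ultimately show ?thesis using c by (simp only: of_nat_mult of_nat_power power_add) simp
  qed
  have "glue (abs_plgraph E) (abs_plgraph F) = abs_plgraph ?G"
    using E(1) F(1) by (simp add: glue.abs_eq pl_iso_refl)
  then have "hom_weight A (glue (abs_plgraph E) (abs_plgraph F)) =
    (\<Sum>T\<in>Pow (Pow A). real (card (hom_set A (\<Union>?G) ?G T)) / real (card A) ^ card (\<Union>?G))"
    using E(1) F(1) by (simp add: hom_weight.abs_eq pl_iso_refl pl_graph_glue)
  also have "\<dots> = (\<Sum>T\<in>Pow (Pow A). real (card (hom_set A ?W ?G T)) / real (card A) ^ card ?W)"
    by (simp only: norm)
  also have "\<dots> = (\<Sum>T\<in>Pow (Pow A). real (card (hom_set A ?W ?G T))) / real (card A) ^ card ?W"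
    by (simp only: sum_divide_distrib)
  finally show ?thesis
    by (simp add: card_hom_set_glue[OF V A(1) E(2) F(2)])
qed

text \<open>
  Equal numbers of homomorphisms into all targets give, by induction on the target, equal numbers
  of homomorphisms that are onto the edges of the target. For the target \<open>E\<close> itself, the identity
  is one.
\<close>

lemma ex_map_onto_if_hom_fiber_card_eq:
  assumes V: "finite V" and EV: "\<Union>E \<subseteq> V" "\<Union>F \<subseteq> V"
    and eq: "\<And>T \<phi>. T \<subseteq> Pow V \<Longrightarrow> \<phi> \<in> labeled_part V \<rightarrow>\<^sub>E V \<Longrightarrow>
        card (hom_fiber V V E T \<phi>) = card (hom_fiber V V F T \<phi>)"
  shows "\<exists>\<psi>. rename \<psi> F = E \<and> (\<forall>v\<in>labeled_part V. \<psi> v = v)"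
proof -
  define onto where "onto H T \<phi> = {\<psi> \<in> hom_fiber V V H T \<phi>. rename \<psi> H = T}" for H T \<phi>
  have fin: "finite (hom_fiber V V H T \<phi>)" for H T \<phi>
    using V by (simp add: finite_hom_fiber)
  \<comment> \<open>Homomorphisms into \<open>T\<close> are sorted by the edge set \<open>T'\<close>
    that they actually hit.\<close>
  have split: "card (hom_fiber V V H T \<phi>) = card (onto H T \<phi>) + (\<Sum>T'\<in>{T'. T' \<subset> T}. card (onto H T' \<phi>))"
    if T: "T \<subseteq> Pow V" for H T \<phi>
  proof -
    have finT: "finite T" using V T by (meson finite_Pow_iff finite_subset)
    have fin': "finite {T'. T' \<subset> T}" using finT by (auto intro: finite_subset[of _ "Pow T"])
    have "hom_fiber V V H T \<phi> = onto H T \<phi> \<union> (\<Union>T'\<in>{T'. T' \<subset> T}. onto H T' \<phi>)"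
      unfolding onto_def hom_fiber_def hom_set_def by auto
    moreover have "card (\<Union>T'\<in>{T'. T' \<subset> T}. onto H T' \<phi>) = (\<Sum>T'\<in>{T'. T' \<subset> T}. card (onto H T' \<phi>))"
      using fin' fin by (intro card_UN_disjoint) (auto simp: onto_def)
    moreover have "onto H T \<phi> \<inter> (\<Union>T'\<in>{T'. T' \<subset> T}. onto H T' \<phi>) = {}" by (auto simp: onto_def)
    moreover have "finite (onto H T' \<phi>)" for T' using fin by (simp add: onto_def)
    ultimately show ?thesis using fin' by (simp add: card_Un_disjoint)
  qed
  have onto_eq: "T \<subseteq> Pow V \<Longrightarrow> card (onto E T \<phi>) = card (onto F T \<phi>)"
    if phi: "\<phi> \<in> labeled_part V \<rightarrow>\<^sub>E V" for T \<phi>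
  proof (induction "card T" arbitrary: T rule: less_induct)
    case less
    have finT: "finite T" using V less.prems by (meson finite_Pow_iff finite_subset)
    have "(\<Sum>T'\<in>{T'. T' \<subset> T}. card (onto E T' \<phi>)) = (\<Sum>T'\<in>{T'. T' \<subset> T}. card (onto F T' \<phi>))"
      using less finT by (intro sum.cong) (auto intro!: less.hyps psubset_card_mono)
    then show ?case
      using split[OF less.prems, of E \<phi>] split[OF less.prems, of F \<phi>] eq[OF less.prems phi] by simp
  qed
  \<comment> \<open>Prescribing the identity on labeled vertices makes the map obtained from the
    count fix all labels.\<close>
  let ?\<phi> = "restrict id (labeled_part V)"
  have phi: "?\<phi> \<in> labeled_part V \<rightarrow>\<^sub>E V" by (auto simp: labeled_part_def)
  have ren: "rename (restrict id V) E = E" using EV(1) by (intro rename_ident) auto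
  have "restrict id V \<in> onto E E ?\<phi>"
    using ren by (auto simp: onto_def hom_fiber_def hom_set_def labeled_part_def fun_eq_iff)
  moreover have "finite (onto E E ?\<phi>)" using fin by (simp add: onto_def)
  ultimately have "card (onto E E ?\<phi>) > 0" using card_gt_0_iff by blast
  moreover have "E \<subseteq> Pow V" using EV(1) by blast
  ultimately have "card (onto F E ?\<phi>) > 0" using onto_eq[OF phi] by metis
  then obtain \<psi> where psi: "\<psi> \<in> onto F E ?\<phi>" by (metis all_not_in_conv card.empty less_irrefl)
  have "\<psi> v = v" if "v \<in> labeled_part V" for v
  proof -
    have "restrict \<psi> (labeled_part V) = ?\<phi>" using psi by (simp add: onto_def hom_fiber_def)
    then show ?thesis using that by (metis id_apply restrict_apply')
  qed
  then show ?thesis using psi by (auto simp: onto_def)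
qed

text \<open>Surjections in both directions between finite vertex sets are injective. What remains is
  that \<open>f\<close> gives no label to an unlabeled vertex.\<close>

lemma pl_iso_if_maps_onto:
  assumes E: "pl_graph E" "\<Union>E \<subseteq> V" and F: "pl_graph F" "\<Union>F \<subseteq> V"
    and f: "rename f F = E" "\<forall>v\<in>labeled_part V. f v = v"
    and g: "rename g E = F" "\<forall>v\<in>labeled_part V. g v = v"
  shows "pl_iso F E"
proof -
  have fin: "finite (\<Union>E)" "finite (\<Union>F)" using E F by (auto intro!: finite_Union_pl_graph simp del: Union_iff)
  have U: "\<Union>E = f ` \<Union>F" "\<Union>F = g ` \<Union>E" using f g Union_rename by metis+
  have "card (f ` \<Union>F) = card (\<Union>F)"
    using U card_image_le[OF fin(1), of g] card_image_le[OF fin(2), of f] by simp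
  then have inj: "inj_on f (\<Union>F)" using fin by (intro eq_card_imp_inj_on)
  have "label_of (f v) = label_of v" if v: "v \<in> \<Union>F" for v
  proof (cases "label_of v = None")
    case True
    \<comment> \<open>If \<open>f v\<close> were labeled, then \<open>g\<close> would fix it, so it
      would be a vertex of \<open>F\<close>. As \<open>f\<close> fixes it too, injectivity would
      give \<open>f v = v\<close>.\<close>
    have "label_of (f v) = None"
    proof (rule ccontr)
      assume l: "label_of (f v) \<noteq> None"
      have "f v \<in> \<Union>E" using v U by blast
      then have "f v \<in> labeled_part V" using l E by (auto simp: labeled_part_def)
      then have "f (f v) = f v" "g (f v) = f v" using f g by auto
      then have "f v \<in> \<Union>F" using U(2) \<open>f v \<in> \<Union>E\<close> by (metis imageI)
      then have "f v = v" using inj \<open>f (f v) = f v\<close> v by (metis inj_onD)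
      then show False using l True by simp
    qed
    then show ?thesis using True by simp
  next
    case False
    then have "v \<in> labeled_part V" using v F by (auto simp: labeled_part_def)
    then show ?thesis using f by simp
  qed
  then show ?thesis using F(1) inj f(1) by (intro pl_isoI)
qed

text \<open>The defect is a sum of squares of differences of fiber counts. If all of them vanish,
  there are label-fixing maps onto in both directions, so \<open>X\<close> and \<open>Y\<close> are
  isomorphic.\<close>

lemma ex_hom_weight_strict:
  assumes "finite K"
  shows "\<exists>A. \<forall>X\<in>K. \<forall>Y\<in>K. X \<noteq> Y \<longrightarrow>
    2 * hom_weight A (glue X Y) < hom_weight A (glue X X) + hom_weight A (glue Y Y)"
proof -
  have rep: "pl_graph (rep_plgraph X)" "abs_plgraph (rep_plgraph X) = X" for X
    using Quotient_plgraph Quotient_rep_reflp Quotient_abs_rep pl_iso_graph by metis+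
  \<comment> \<open>\<open>V\<close> serves both as the common domain and as the vertex set of the
    targets, so every representative is itself a target.\<close>
  define V where "V = (\<Union>X\<in>K. \<Union>(rep_plgraph X))"
  have V: "finite V" unfolding V_def using assms rep(1) finite_Union_pl_graph by blast
  have sub: "\<Union>(rep_plgraph X) \<subseteq> V" if "X \<in> K" for X using that by (auto simp: V_def)
  have "2 * hom_weight V (glue X Y) < hom_weight V (glue X X) + hom_weight V (glue Y Y)"
    if XY: "X \<in> K" "Y \<in> K" "X \<noteq> Y" for X Y
  proof -
    let ?E = "rep_plgraph X" and ?F = "rep_plgraph Y" and ?P = "labeled_part V \<rightarrow>\<^sub>E V"
    have ne: "V \<noteq> {}"
    proof
      assume "V = {}"
      then have "\<Union>?E = {}" "\<Union>?F = {}" using sub XY by auto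
      then have "?E = {}" "?F = {}" using rep(1) unfolding pl_graph_def
        by (metis Union_empty_conv card.empty ex_in_conv zero_neq_numeral)+
      then show False using rep(2) XY(3) by metis
    qed
    have finP: "finite ?P" using V by (auto intro!: finite_PiE simp: labeled_part_def)
    define h where "h H T \<phi> = real (card (hom_fiber V V (rep_plgraph H) T \<phi>))" for H T \<phi>
    let ?N = "real (card V) ^ card (left_vertex ` V \<union> right_vertex ` V)"
    have N: "?N > 0" using V ne by (simp add: card_gt_0_iff)
    have w: "hom_weight V (glue H H') = (\<Sum>T\<in>Pow (Pow V). \<Sum>\<phi>\<in>?P. h H T \<phi> * h H' T \<phi>) / ?N"
      if "H \<in> K" "H' \<in> K" for H H'
      using hom_weight_abs_glue[OF V V ne rep(1) sub[OF that(1)] rep(1) sub[OF that(2)]]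
      by (simp add: rep(2) h_def)
    have diff: "hom_weight V (glue X X) + hom_weight V (glue Y Y) - 2 * hom_weight V (glue X Y)
      = (\<Sum>T\<in>Pow (Pow V). \<Sum>\<phi>\<in>?P. (h X T \<phi> - h Y T \<phi>)\<^sup>2) / ?N"
      unfolding w[OF XY(1,1)] w[OF XY(2,2)] w[OF XY(1,2)]
      by (simp add: power2_eq_square algebra_simps sum.distrib sum_subtractf sum_distrib_left
          add_divide_distrib diff_divide_distrib)
    have "\<exists>T\<in>Pow (Pow V). \<exists>\<phi>\<in>?P. h X T \<phi> \<noteq> h Y T \<phi>"
    proof (rule ccontr)
      assume "\<not> ?thesis"
      then have eq: "card (hom_fiber V V ?E T \<phi>) = card (hom_fiber V V ?F T \<phi>)"
        if "T \<subseteq> Pow V" "\<phi> \<in> ?P" for T \<phi> using that by (auto simp: h_def)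
      obtain f where f: "rename f ?F = ?E" "\<forall>v\<in>labeled_part V. f v = v"
        using ex_map_onto_if_hom_fiber_card_eq[OF V sub[OF XY(1)] sub[OF XY(2)] eq] by blast
      obtain g where g: "rename g ?E = ?F" "\<forall>v\<in>labeled_part V. g v = v"
        using ex_map_onto_if_hom_fiber_card_eq[OF V sub[OF XY(2)] sub[OF XY(1)] eq[symmetric]] by blast
      have "pl_iso ?F ?E"
        by (rule pl_iso_if_maps_onto[OF rep(1) sub[OF XY(1)] rep(1) sub[OF XY(2)] f g])
      then have "abs_plgraph ?F = abs_plgraph ?E" using Quotient_plgraph Quotient_rel_abs by metis
      then show False using rep(2) XY(3) by metis
    qed
    then obtain T \<phi> where T: "T \<in> Pow (Pow V)" and phi: "\<phi> \<in> ?P" and neq: "h X T \<phi> \<noteq> h Y T \<phi>" by blast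
    have "0 < (\<Sum>T\<in>Pow (Pow V). \<Sum>\<phi>\<in>?P. (h X T \<phi> - h Y T \<phi>)\<^sup>2)"
    proof (rule sum_pos2[OF _ T])
      show "finite (Pow (Pow V))" using V by simp
      show "0 < (\<Sum>\<phi>\<in>?P. (h X T \<phi> - h Y T \<phi>)\<^sup>2)"
        by (rule sum_pos2[OF finP phi]) (use neq in auto)
      show "0 \<le> (\<Sum>\<phi>\<in>?P. (h X S \<phi> - h Y S \<phi>)\<^sup>2)" for S by (rule sum_nonneg) simp
    qed
    then show ?thesis using diff N by (smt (verit) divide_pos_pos)
  qed
  then show ?thesis by blast
qed

section \<open>Squares and coefficients\<close>

text \<open>With a 0/1-valued \<open>\<omega>\<close>, this linear functional adds up the
  coefficients of a selected set of graphs.\<close>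

definition eval_at :: "(plgraph \<Rightarrow> real) \<Rightarrow> graph_combination \<Rightarrow> real" where
  "eval_at \<omega> x = (\<Sum>G\<in>Poly_Mapping.keys x. Poly_Mapping.lookup x G * \<omega> G)"

lemma eval_at_superset:
  assumes "finite S" "Poly_Mapping.keys x \<subseteq> S"
  shows "eval_at \<omega> x = (\<Sum>G\<in>S. Poly_Mapping.lookup x G * \<omega> G)"
  unfolding eval_at_def using assms by (intro sum.mono_neutral_left) (auto simp: in_keys_iff)

lemma linear_eval_at: "linear (eval_at \<omega>)"
proof (rule linearI)
  fix a b :: graph_combination and c :: real
  let ?S = "Poly_Mapping.keys a \<union> Poly_Mapping.keys b"
  have "finite ?S" "Poly_Mapping.keys (a + b) \<subseteq> ?S" by (simp_all add: keys_add)
  then show "eval_at \<omega> (a + b) = eval_at \<omega> a + eval_at \<omega> b"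
    by (simp add: eval_at_superset[of ?S] lookup_add distrib_right sum.distrib)
  have "Poly_Mapping.keys (c *\<^sub>R a) \<subseteq> Poly_Mapping.keys a"
    by (auto simp: in_keys_iff lookup_scaleR_graph)
  then show "eval_at \<omega> (c *\<^sub>R a) = c *\<^sub>R eval_at \<omega> a"
    by (simp add: eval_at_superset[of "Poly_Mapping.keys a"] lookup_scaleR_graph sum_distrib_left mult.assoc)
qed

lemma eval_at_of_graph [simp]: "eval_at \<omega> (of_graph G) = \<omega> G"
  by (simp add: eval_at_def of_graph_def)

lemma sum_of_graph: "a = (\<Sum>X\<in>Poly_Mapping.keys a. Poly_Mapping.lookup a X *\<^sub>R of_graph X)"
  by (rule poly_mapping_eqI)
     (auto simp: lookup_sum lookup_scaleR_graph of_graph_def lookup_single when_def in_keys_iff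
        if_distrib sum.delta cong: if_cong)

lemma of_graph_scaleR_mult:
  "(c *\<^sub>R of_graph X) * (d *\<^sub>R of_graph Y) = (c * d) *\<^sub>R of_graph (glue X Y)"
proof -
  have single: "r *\<^sub>R of_graph Z = Poly_Mapping.single Z r" for r Z
    by (rule poly_mapping_eqI) (simp add: lookup_scaleR_graph of_graph_def lookup_single when_def)
  show ?thesis by (simp add: single mult_single plus_plgraph_def)
qed

lemma eval_at_unlabel_square:
  "eval_at \<omega> (unlabel (a\<^sup>2)) = (\<Sum>X\<in>Poly_Mapping.keys a. \<Sum>Y\<in>Poly_Mapping.keys a.
     Poly_Mapping.lookup a X * Poly_Mapping.lookup a Y * \<omega> (unlabel_graph (glue X Y)))"
proof -
  interpret L: linear "\<lambda>x. eval_at \<omega> (unlabel x)"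
    using linear_compose[OF linear_unlabel linear_eval_at] by (simp add: comp_def)
  have "a\<^sup>2 = (\<Sum>X\<in>Poly_Mapping.keys a. \<Sum>Y\<in>Poly_Mapping.keys a.
     (Poly_Mapping.lookup a X * Poly_Mapping.lookup a Y) *\<^sub>R of_graph (glue X Y))"
  proof -
    have "a\<^sup>2 = (\<Sum>X\<in>Poly_Mapping.keys a. Poly_Mapping.lookup a X *\<^sub>R of_graph X) *
        (\<Sum>X\<in>Poly_Mapping.keys a. Poly_Mapping.lookup a X *\<^sub>R of_graph X)"
      by (simp only: power2_eq_square sum_of_graph[symmetric])
    also have "\<dots> = (\<Sum>X\<in>Poly_Mapping.keys a. \<Sum>Y\<in>Poly_Mapping.keys a.
     (Poly_Mapping.lookup a X * Poly_Mapping.lookup a Y) *\<^sub>R of_graph (glue X Y))"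
      by (simp add: sum_product of_graph_scaleR_mult)
    finally show ?thesis .
  qed
  then show ?thesis
    by (simp add: L.sum L.scale unlabel_of_graph)
qed

section \<open>Extremal argument against sums of squares\<close>

lemma not_sos_trivial_square:
  assumes triv: "trivial_square F" and deg: "nedges G = nedges F" and ne: "G \<noteq> F"
  shows "\<not> sos (c *\<^sub>R of_graph F - of_graph G)"
proof
  let ?f = "c *\<^sub>R of_graph F - of_graph G" and ?q = "\<lambda>X Y. unlabel_graph (glue X Y)"
  assume "sos ?f"
  then obtain as where as: "?f = (\<Sum>a\<leftarrow>as. unlabel (a\<^sup>2))" by (auto simp: sos_def)
  have ev: "c * \<omega> F - \<omega> G = (\<Sum>a\<leftarrow>as. \<Sum>X\<in>Poly_Mapping.keys a. \<Sum>Y\<in>Poly_Mapping.keys a.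
     Poly_Mapping.lookup a X * Poly_Mapping.lookup a Y * \<omega> (?q X Y))" for \<omega>
  proof -
    interpret L: linear "eval_at \<omega>" by (rule linear_eval_at)
    have "eval_at \<omega> (\<Sum>a\<leftarrow>as. unlabel (a\<^sup>2)) = (\<Sum>a\<leftarrow>as. eval_at \<omega> (unlabel (a\<^sup>2)))"
      by (induction as) (simp_all add: L.zero L.add)
    moreover have "eval_at \<omega> ?f = c * \<omega> F - \<omega> G" by (simp add: L.diff L.scale)
    ultimately show ?thesis using as by (simp add: eval_at_unlabel_square)
  qed
  define K where "K = (\<Union>a\<in>set as. Poly_Mapping.keys a)"
  have K: "finite K" by (simp add: K_def)
  define Q where "Q = {X\<in>K. ?q X X \<noteq> F}"
  have full: "fully_labeled X \<and> nedges X = nedges F" if "?q X X = F" for X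
    using triv that unfolding trivial_square_def by (metis nedges_unlabel)
  have same: "Y = X" if "?q X X = F" "nedges (glue X Y) \<le> nedges F" "nedges F \<le> nedges (glue Y Y)" for X Y
    using that full eq_of_nedges_glue_le by metis
  \<comment> \<open>The coefficient of \<open>G\<close> is -1, so some product of occurring graphs
    must yield \<open>G\<close>. The indicator of \<open>G\<close> detects this.\<close>
  obtain a X Y where aXY: "a \<in> set as" "X \<in> Poly_Mapping.keys a" "Y \<in> Poly_Mapping.keys a" "?q X Y = G"
  proof -
    define \<omega> :: "plgraph \<Rightarrow> real" where "\<omega> H = (if H = G then 1 else 0)" for H
    have False if no: "\<And>a X Y. a \<in> set as \<Longrightarrow> X \<in> Poly_Mapping.keys a \<Longrightarrow> Y \<in> Poly_Mapping.keys a \<Longrightarrow> ?q X Y \<noteq> G"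
    proof -
      have "(\<Sum>a\<leftarrow>as. \<Sum>X\<in>Poly_Mapping.keys a. \<Sum>Y\<in>Poly_Mapping.keys a.
         Poly_Mapping.lookup a X * Poly_Mapping.lookup a Y * \<omega> (?q X Y)) = (\<Sum>a\<leftarrow>as. 0)"
        using no by (intro arg_cong[where f = sum_list] map_cong refl sum.neutral ballI) (auto simp: \<omega>_def)
      then show False using ev[of \<omega>] ne by (simp add: \<omega>_def)
    qed
    then show ?thesis using that by blast
  qed
  have XYK: "X \<in> K" "Y \<in> K" using aXY by (auto simp: K_def)
  have dXY: "nedges (glue X Y) = nedges F" using aXY(4) deg by (metis nedges_unlabel)
  \<comment> \<open>Otherwise every square has at least \<open>nedges F\<close> edges, with equality
    only for \<open>F\<close>. Midpoint convexity, applied to the product yielding \<open>G\<close>,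
    then makes \<open>X\<close> a fully labeled copy of \<open>F\<close>, and rigidity gives
    \<open>Y = X\<close>, hence \<open>G = F\<close>.\<close>
  have "\<exists>Z\<in>Q. nedges (glue Z Z) \<le> nedges F"
  proof (rule ccontr)
    assume no: "\<not> ?thesis"
    have big: "nedges F \<le> nedges (glue Z Z) \<and> (nedges (glue Z Z) = nedges F \<longrightarrow> ?q Z Z = F)" if "Z \<in> K" for Z
    proof (cases "?q Z Z = F")
      case True
      then show ?thesis by (metis nedges_unlabel order_refl)
    next
      case False
      then show ?thesis using no that by (auto simp: Q_def)
    qed
    have "nedges (glue X X) = nedges F"
      using nedges_glue_midpoint[of X Y] big[OF XYK(1)] big[OF XYK(2)] dXY by linarith
    then have "?q X X = F" using big XYK by blast
    then have "Y = X" using same dXY big XYK by simp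
    then show False using \<open>?q X X = F\<close> aXY(4) ne by simp
  qed
  then obtain Z where Z: "Z \<in> Q" "nedges (glue Z Z) \<le> nedges F" by blast
  have finQ: "finite Q" using K by (simp add: Q_def)
  define d where "d = Min ((\<lambda>X. nedges (glue X X)) ` Q)"
  have d: "d \<le> nedges (glue X X)" if "X \<in> Q" for X using that finQ by (simp add: d_def)
  have dF: "d \<le> nedges F" using d[OF Z(1)] Z(2) by simp
  have "d \<in> (\<lambda>X. nedges (glue X X)) ` Q" unfolding d_def using finQ Z by (intro Min_in) auto
  then obtain Z' where Z': "Z' \<in> Q" "nedges (glue Z' Z') = d" by auto
  obtain A where A: "\<And>X Y. X \<in> K \<Longrightarrow> Y \<in> K \<Longrightarrow> X \<noteq> Y \<Longrightarrow>
      2 * hom_weight A (glue X Y) < hom_weight A (glue X X) + hom_weight A (glue Y Y)"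
    using ex_hom_weight_strict[OF K] by blast
  define R where "R = {X\<in>Q. nedges (glue X X) = d}"
  have finR: "finite R" "Z' \<in> R" using finQ Z' by (auto simp: R_def)
  define m where "m = Max ((\<lambda>X. hom_weight A (glue X X)) ` R)"
  have m: "hom_weight A (glue X X) \<le> m" if "X \<in> R" for X using that finR by (simp add: m_def)
  have "m \<in> (\<lambda>X. hom_weight A (glue X X)) ` R" unfolding m_def using finR by (intro Max_in) auto
  then obtain M where M: "M \<in> R" "hom_weight A (glue M M) = m" by auto
  \<comment> \<open>\<open>F\<close> is left out because its coefficient \<open>c\<close> may have
    any sign.\<close>
  define \<omega> :: "plgraph \<Rightarrow> real" where
    "\<omega> H = (if H \<noteq> F \<and> nedges H = d \<and> hom_weight A H = m then 1 else 0)" for H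
  \<comment> \<open>By \<open>rigid\<close> neither factor squares to \<open>F\<close>. So both lie
    in \<open>Q\<close>, and minimality of \<open>d\<close> with the midpoint inequality puts both
    in \<open>R\<close>. Strict convexity then makes the weight of the product smaller than
    \<open>m\<close>.\<close>
  have off: "\<omega> (?q X Y) = 0" if XY: "X \<in> K" "Y \<in> K" "X \<noteq> Y" for X Y
  proof (rule ccontr)
    assume "\<omega> (?q X Y) \<noteq> 0"
    then have q: "?q X Y \<noteq> F" "nedges (glue X Y) = d" "hom_weight A (glue X Y) = m"
      by (auto simp: \<omega>_def split: if_splits)
    \<comment> \<open>A factor with square \<open>F\<close> has \<open>nedges F\<close> edges, which
      squeezes \<open>d\<close> to \<open>nedges F\<close>. Then \<open>same\<close>
      applies.\<close>
    have rigid: False if "X' \<in> K" "Y' \<in> K" "X' \<noteq> Y'" "?q X' X' = F" "nedges (glue X' Y') = d" for X' Y'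
    proof -
      have "nedges F \<le> d" using nedges_le_glue[of X' Y'] full[OF that(4)] that(5) by simp
      then have "d = nedges F" using dF by simp
      moreover have "nedges F \<le> nedges (glue Y' Y')"
      proof (cases "?q Y' Y' = F")
        case True
        then show ?thesis by (metis nedges_unlabel order_refl)
      next
        case False
        then show ?thesis using d[of Y'] that(2) \<open>d = nedges F\<close> by (simp add: Q_def)
      qed
      ultimately show False using same[OF that(4), of Y'] that(3,5) by simp
    qed
    have comm: "glue Y X = glue X Y" by (metis add.commute plus_plgraph_def)
    have "X \<in> Q" "Y \<in> Q"
      using rigid[of X Y] rigid[of Y X] XY q(2) comm by (auto simp: Q_def)
    then have "X \<in> R" "Y \<in> R"
      using nedges_glue_midpoint[of X Y] d[of X] d[of Y] q(2) by (auto simp: R_def)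
    then show False using m[of X] m[of Y] A[OF XY] q(3) by simp
  qed
  have diag: "\<omega> (?q X X) \<ge> 0" for X by (simp add: \<omega>_def)
  define s where "s a = (\<Sum>X\<in>Poly_Mapping.keys a. (Poly_Mapping.lookup a X)\<^sup>2 * \<omega> (?q X X))" for a
  have "(\<Sum>X\<in>Poly_Mapping.keys a. \<Sum>Y\<in>Poly_Mapping.keys a.
     Poly_Mapping.lookup a X * Poly_Mapping.lookup a Y * \<omega> (?q X Y)) = s a" if a: "a \<in> set as" for a
    unfolding s_def
  proof (intro sum.cong refl)
    fix X assume X: "X \<in> Poly_Mapping.keys a"
    have "(\<Sum>Y\<in>Poly_Mapping.keys a. Poly_Mapping.lookup a X * Poly_Mapping.lookup a Y * \<omega> (?q X Y))
       = (\<Sum>Y\<in>Poly_Mapping.keys a. if Y = X then (Poly_Mapping.lookup a X)\<^sup>2 * \<omega> (?q X X) else 0)"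
      using off a X by (intro sum.cong refl) (auto simp: K_def power2_eq_square)
    then show "(\<Sum>Y\<in>Poly_Mapping.keys a. Poly_Mapping.lookup a X * Poly_Mapping.lookup a Y * \<omega> (?q X Y))
       = (Poly_Mapping.lookup a X)\<^sup>2 * \<omega> (?q X X)" using X by simp
  qed
  then have "c * \<omega> F - \<omega> G = (\<Sum>a\<leftarrow>as. s a)"
    unfolding ev by (intro arg_cong[where f = sum_list] map_cong refl)
  moreover have "\<omega> F = 0" "\<omega> G \<ge> 0" by (auto simp: \<omega>_def)
  ultimately have le: "(\<Sum>a\<leftarrow>as. s a) \<le> 0" by simp
  have s0: "s a \<ge> 0" for a unfolding s_def using diag by (intro sum_nonneg) simp
  \<comment> \<open>The square of the extremal graph \<open>M\<close> contributes a positive amount,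
    which contradicts \<open>le\<close>.\<close>
  obtain b where b: "b \<in> set as" "M \<in> Poly_Mapping.keys b" using M by (auto simp: R_def Q_def K_def)
  have "\<omega> (?q M M) = 1" using M by (auto simp: \<omega>_def R_def Q_def)
  then have "s b > 0" unfolding s_def using b diag
    by (intro sum_pos2[of _ M]) (auto simp: in_keys_iff)
  moreover have "s b \<le> (\<Sum>a\<leftarrow>as. s a)" using b(1) s0 by (intro member_le_sum_list) auto
  ultimately show False using le by simp
qed

section \<open>Odd paths and disjoint edges\<close>

lemma nedges_path_graph: "nedges (path_graph k) = k"
proof transfer
  fix k
  have "inj_on (\<lambda>i. {Unlabeled i, Unlabeled (i + 1)}) {..<k}"
    by (rule inj_onI) (auto simp: doubleton_eq_iff)
  then show "card ((\<lambda>i. {Unlabeled i, Unlabeled (i + 1)}) ` {..<k}) = k" by (simp add: card_image)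
qed

text \<open>An inequality also covers \<open>k = 0\<close>, where the path is the empty graph
  without vertices.\<close>

lemma nverts_path_graph: "nverts (path_graph k) \<le> k + 1"
proof transfer
  fix k
  have "\<Union>((\<lambda>i. {Unlabeled i, Unlabeled (i + 1)}) ` {..<k}) \<subseteq> Unlabeled ` {..k}" by auto
  then have "card (\<Union>((\<lambda>i. {Unlabeled i, Unlabeled (i + 1)}) ` {..<k})) \<le> card (Unlabeled ` {..k})"
    by (intro card_mono) auto
  also have "\<dots> = k + 1" by (simp add: card_image inj_on_def)
  finally show "card (\<Union>((\<lambda>i. {Unlabeled i, Unlabeled (i + 1)}) ` {..<k})) \<le> k + 1" .
qed

lemma glue_unlabeled:
  assumes "unlabeled X"
  shows "nedges (glue X Y) = nedges X + nedges Y" "nverts (glue X Y) = nverts X + nverts Y"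
proof -
  show "nedges (glue X Y) = nedges X + nedges Y" using assms
  proof transfer
    fix E F assume iso: "pl_iso E E" "pl_iso F F" and "\<forall>v\<in>\<Union>E. label_of v = None"
    then have "labeled_edges E \<inter> labeled_edges F \<subseteq> {{}}"
      by (auto simp: labeled_edges_def)
    moreover have "{} \<notin> E" using iso unfolding pl_iso_def pl_graph_def by (metis card.empty zero_neq_numeral)
    ultimately have "labeled_edges E \<inter> labeled_edges F = {}" by (auto simp: labeled_edges_def)
    then show "card (glue_raw E F) = card E + card F"
      using card_glue_raw[of E F] iso by (simp add: pl_iso_def pl_graph_finite)
  qed
  show "nverts (glue X Y) = nverts X + nverts Y" using assms
  proof transfer
    fix E F assume iso: "pl_iso E E" "pl_iso F F" and un: "\<forall>v\<in>\<Union>E. label_of v = None"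
    have fin: "finite (\<Union>E)" "finite (\<Union>F)" using iso by (auto dest!: pl_iso_graph intro!: finite_Union_pl_graph simp del: Union_iff)
    have "left_vertex ` \<Union>E \<inter> right_vertex ` \<Union>F = {}"
      using un by (auto simp: left_eq_right_iff simp del: Union_iff)
    then have "card (\<Union>(glue_raw E F)) = card (left_vertex ` \<Union>E) + card (right_vertex ` \<Union>F)"
      unfolding Union_glue using fin by (intro card_Un_disjoint) auto
    then show "card (\<Union>(glue_raw E F)) = card (\<Union>E) + card (\<Union>F)"
      by (simp add: card_image inj_on_subset[OF inj_left_vertex] inj_on_subset[OF inj_right_vertex])
  qed
qed

text \<open>The number of edges agrees with that of the path. The number of vertices is what tells
  the two graphs apart.\<close>

lemma edge_power_graph:
  "\<exists>G. of_graph edge_graph ^ k = of_graph G \<and> nedges G = k \<and> nverts G = 2 * k"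
proof (induction k)
  case 0
  have "nedges empty_graph = 0" "nverts empty_graph = 0" by (transfer, simp)+
  then show ?case using of_graph_empty by auto
next
  case (Suc k)
  then obtain G where G: "of_graph edge_graph ^ k = of_graph G" "nedges G = k" "nverts G = 2 * k" by blast
  have "nedges edge_graph = 1" "nverts edge_graph = 2" by (transfer, simp)+
  then have "nedges (glue edge_graph G) = Suc k" "nverts (glue edge_graph G) = 2 * Suc k"
    using G glue_unlabeled[OF unlabeled_edge_graph, of G] by auto
  then show ?case using G(1) by (metis of_graph_glue power_Suc)
qed

section \<open>Odd paths as trivial squares\<close>

lemma fully_labeled_if_path_square_raw:
  assumes E: "pl_graph E" and k: "odd k"
    and iso: "pl_iso ((\<lambda>i. {Unlabeled i, Unlabeled (i + 1)}) ` {..<k}) (rename unlabel_vertex (glue_raw E E))"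
  shows "\<forall>v\<in>\<Union>E. label_of v \<noteq> None"
proof -
  let ?P = "(\<lambda>i. {Unlabeled i, Unlabeled (i + 1)}) ` {..<k}" and ?G = "glue_raw E E" and ?u = unlabel_vertex
  obtain f where f: "inj_on f (\<Union>?P)" "rename f ?P = rename ?u ?G"
    using iso unfolding pl_iso_def by blast
  have UP: "\<Union>?P = Unlabeled ` {..k}"
  proof -
    have "Unlabeled i \<in> \<Union>?P" if "i \<le> k" for i
    proof (cases "i < k")
      case False
      then have "i = (k - 1) + 1" "k - 1 < k" using that k by (auto simp: odd_pos)
      then show ?thesis by (metis (mono_tags, lifting) UN_I insertCI lessThan_iff)
    qed auto
    then show ?thesis by auto
  qed
  \<comment> \<open>The path is pulled back through \<open>?u\<close> into the product itself, where
    the labels are still visible.\<close>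
  define p where "p i = inv ?u (f (Unlabeled i))" for i
  have up: "?u (p i) = f (Unlabeled i)" and pU: "p i \<in> \<Union>?G" if "i \<le> k" for i
  proof -
    have "f (Unlabeled i) \<in> f ` \<Union>?P" using that UP by blast
    then have "f (Unlabeled i) \<in> ?u ` \<Union>?G" using f(2) Union_rename by metis
    then show "?u (p i) = f (Unlabeled i)" "p i \<in> \<Union>?G"
      by (auto simp: p_def inj_unlabel_vertex simp del: Union_iff)
  qed
  have injp: "p i = p j \<Longrightarrow> i = j" if "i \<le> k" "j \<le> k" for i j
  proof -
    assume "p i = p j"
    then have "f (Unlabeled i) = f (Unlabeled j)" using up that by metis
    then have "Unlabeled i = Unlabeled j" using f(1) that unfolding UP by (auto dest!: inj_onD)
    then show "i = j" by simp
  qed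
  have G: "?G = (\<lambda>i. {p i, p (i + 1)}) ` {..<k}"
  proof -
    have "?G = rename (inv ?u \<circ> ?u) ?G" by (rule rename_ident[symmetric]) (simp add: inj_unlabel_vertex)
    also have "\<dots> = rename (inv ?u \<circ> f) ?P" using f(2) by (metis rename_comp)
    finally show ?thesis by (simp add: rename_def image_image p_def)
  qed
  have cardG: "card ?G = k"
  proof -
    have "inj_on (\<lambda>i. {p i, p (i + 1)}) {..<k}"
    proof (rule inj_onI)
      fix x y assume xy: "x \<in> {..<k}" "y \<in> {..<k}" "{p x, p (x + 1)} = {p y, p (y + 1)}"
      then consider "p x = p y" | "p x = p (y + 1)" "p (x + 1) = p y" by (auto simp: doubleton_eq_iff)
      then show "x = y"
      proof cases
        case 1
        then show ?thesis using injp[of x y] xy by simp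
      next
        case 2
        then show ?thesis using injp[of x "y + 1"] injp[of "x + 1" y] xy by simp
      qed
    qed
    then show ?thesis unfolding G by (simp add: card_image)
  qed
  \<comment> \<open>The square has twice \<open>card E\<close> edges minus the number of fully
    labeled ones, and \<open>k\<close> is odd.\<close>
  have "labeled_edges E \<noteq> {}"
    using card_glue_raw[of E E] cardG k E by (auto simp: pl_graph_finite)
  then obtain e where e: "e \<in> E" "\<forall>v\<in>e. label_of v \<noteq> None" by (auto simp: labeled_edges_def)
  then have "left_vertex ` e = e" using left_labeled by force
  then have "e \<in> ?G" using e(1) unfolding glue_raw_def rename_def by blast
  then obtain i where i: "i < k" "e = {p i, p (i + 1)}" unfolding G by auto
  define lab where "lab j \<longleftrightarrow> label_of (p j) \<noteq> None" for j
  have lab_i: "lab i" "lab (i + 1)" using e i by (auto simp: lab_def)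
  have adj: "{p j, y} \<in> ?G \<Longrightarrow> y = p (j + 1) \<or> (j > 0 \<and> y = p (j - 1))" if "j \<le> k" for j y
  proof -
    assume "{p j, y} \<in> ?G"
    then obtain l where l: "l < k" "{p j, y} = {p l, p (l + 1)}" unfolding G by auto
    then have "(p j = p l \<and> y = p (l + 1)) \<or> (p j = p (l + 1) \<and> y = p l)" by (auto simp: doubleton_eq_iff)
    then show ?thesis using injp[OF that, of l] injp[OF that, of "l + 1"] l by auto
  qed
  \<comment> \<open>The neighbour \<open>y\<close> comes from an unlabeled \<open>y'\<close> in
    \<open>E\<close>. Both copies of \<open>y'\<close> are adjacent to \<open>x\<close>, and one of
    them differs from \<open>y\<close>.\<close>
  have twin: "\<exists>z. z \<noteq> y \<and> label_of z = None \<and> {x, z} \<in> ?G"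
    if xy: "{x, y} \<in> ?G" and x: "label_of x \<noteq> None" and y: "label_of y = None" for x y
  proof -
    have "\<exists>y'. {x, y'} \<in> E \<and> label_of y' = None"
    proof -
      from xy consider e' where "e' \<in> E" "{x, y} = left_vertex ` e'" | e' where "e' \<in> E" "{x, y} = right_vertex ` e'"
        unfolding glue_raw_def rename_def by blast
      then show ?thesis
      proof cases
        case 1
        obtain v w where vw: "v \<in> e'" "w \<in> e'" "x = left_vertex v" "y = left_vertex w" using 1(2) by (metis imageE insertCI)
        then have "v = x" using x by simp
        have "e' = {v, w}"
        proof -
          have "left_vertex ` e' = left_vertex ` {v, w}" using 1(2) vw by simp
          then show ?thesis using inj_left_vertex by (simp only: inj_image_eq_iff)
        qed
        then have "{x, w} \<in> E" using 1(1) \<open>v = x\<close> by simp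
        moreover have "label_of w = None" using y vw(4) by simp
        ultimately show ?thesis by blast
      next
        case 2
        obtain v w where vw: "v \<in> e'" "w \<in> e'" "x = right_vertex v" "y = right_vertex w" using 2(2) by (metis imageE insertCI)
        then have "v = x" using x by simp
        have "e' = {v, w}"
        proof -
          have "right_vertex ` e' = right_vertex ` {v, w}" using 2(2) vw by simp
          then show ?thesis using inj_right_vertex by (simp only: inj_image_eq_iff)
        qed
        then have "{x, w} \<in> E" using 2(1) \<open>v = x\<close> by simp
        moreover have "label_of w = None" using y vw(4) by simp
        ultimately show ?thesis by blast
      qed
    qed
    then obtain y' where y': "{x, y'} \<in> E" "label_of y' = None" by blast
    have "left_vertex ` {x, y'} \<in> ?G" "right_vertex ` {x, y'} \<in> ?G"
      using y'(1) unfolding glue_raw_def rename_def by blast+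
    then have "{x, left_vertex y'} \<in> ?G" "{x, right_vertex y'} \<in> ?G" using x by simp_all
    moreover have "left_vertex y' \<noteq> right_vertex y'" using y'(2) by (simp add: left_eq_right_iff)
    ultimately show ?thesis using y'(2) by (metis label_of_left label_of_right)
  qed
  have edge: "{p j, p (j + 1)} \<in> ?G" if "j < k" for j using that unfolding G by blast
  \<comment> \<open>The twin of an unlabeled \<open>p (j + 2)\<close> could only be the other
    neighbour \<open>p j\<close> of \<open>p (j + 1)\<close>, but that one is labeled.
    \<open>down_step\<close> is the mirror image.\<close>
  have up_step: "lab (j + 2)" if l: "lab j" "lab (j + 1)" "j + 2 \<le> k" for j
  proof (rule ccontr)
    assume "\<not> lab (j + 2)"
    then have "label_of (p (j + 2)) = None" by (simp add: lab_def)
    moreover have "{p (j + 1), p (j + 2)} \<in> ?G" using edge[of "j + 1"] that(3) by simp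
    ultimately obtain z where z: "z \<noteq> p (j + 2)" "label_of z = None" "{p (j + 1), z} \<in> ?G"
      using twin l(2) unfolding lab_def by blast
    then have "z = p j" using adj[of "j + 1" z] that(3) by simp
    then show False using z(2) that(1) by (simp add: lab_def)
  qed
  have down_step: "lab j" if l: "lab (j + 1)" "lab (j + 2)" "j + 2 \<le> k" for j
  proof (rule ccontr)
    assume "\<not> lab j"
    then have "label_of (p j) = None" by (simp add: lab_def)
    moreover have "{p (j + 1), p j} \<in> ?G" using edge[of j] that(3) by (simp add: insert_commute)
    ultimately obtain z where z: "z \<noteq> p j" "label_of z = None" "{p (j + 1), z} \<in> ?G"
      using twin l(1) unfolding lab_def by blast
    then have "z = p (j + 2)" using adj[of "j + 1" z] that(3) by simp
    then show False using z(2) that(2) by (simp add: lab_def)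
  qed
  have up_all: "i + l + 1 \<le> k \<longrightarrow> lab (i + l) \<and> lab (i + l + 1)" for l
  proof (induction l)
    case (Suc l)
    then show ?case using up_step[of "i + l"] by simp
  qed (use lab_i in simp)
  have down_all: "l \<le> i \<longrightarrow> lab (i - l) \<and> lab (i - l + 1)" for l
  proof (induction l)
    case (Suc l)
    show ?case
    proof
      assume l: "Suc l \<le> i"
      then have "i - l = (i - Suc l) + 1" by simp
      then show "lab (i - Suc l) \<and> lab (i - Suc l + 1)"
        using Suc l i(1) down_step[of "i - Suc l"] by simp
    qed
  qed (use lab_i in simp)
  have all: "lab j" if "j \<le> k" for j
  proof (cases "j \<le> i")
    case True
    then show ?thesis using down_all[of "i - j"] by simp
  next
    case False
    then show ?thesis using up_all[of "j - i - 1"] that by simp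
  qed
  show ?thesis
  proof
    fix v assume "v \<in> \<Union>E"
    then have "left_vertex v \<in> \<Union>?G" by (auto simp: Union_glue simp del: Union_iff)
    then obtain j where "j < k" "left_vertex v \<in> {p j, p (j + 1)}" unfolding G by auto
    moreover have "label_of (p j) \<noteq> None" "label_of (p (j + 1)) \<noteq> None"
      using all[of j] all[of "j + 1"] \<open>j < k\<close> by (simp_all add: lab_def)
    ultimately have "label_of (left_vertex v) \<noteq> None" by (metis insertE singletonD)
    then show "label_of v \<noteq> None" by simp
  qed
qed

text \<open>Once \<open>H\<close> is fully labeled, gluing it to itself changes nothing, so
  unlabeling \<open>H\<close> already gives the path.\<close>

lemma trivial_square_path_graph:
  assumes "odd k"
  shows "trivial_square (path_graph k)"
proof -
  have "fully_labeled H" if "path_graph k = unlabel_graph (glue H H)" for H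
    using that assms
  proof transfer
    fix k E
    assume "pl_iso E E" and "odd k"
      and "pl_iso ((\<lambda>i. {Unlabeled i, Unlabeled (i + 1)}) ` {..<k}) (rename unlabel_vertex (glue_raw E E))"
    then show "\<forall>v\<in>\<Union>E. label_of v \<noteq> None"
      using fully_labeled_if_path_square_raw pl_iso_graph by blast
  qed
  then show ?thesis
    unfolding trivial_square_def using unlabeled_path_graph glue_self_fully_labeled by metis
qed

theorem corollary1p3:
  fixes k :: nat
  assumes "k \<ge> 3" and "odd k"
  shows "trivial_square (path_graph k) \<and>
    (\<forall>c::real. c *\<^sub>R of_graph (path_graph k) - of_graph edge_graph ^ k \<in> unlabeled_algebra \<and>
       \<not> sos (c *\<^sub>R of_graph (path_graph k) - of_graph edge_graph ^ k))"
proof (intro conjI allI)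
  show triv: "trivial_square (path_graph k)" using assms(2) by (rule trivial_square_path_graph)
  fix c :: real
  show "c *\<^sub>R of_graph (path_graph k) - of_graph edge_graph ^ k \<in> unlabeled_algebra"
    by (rule path_edge_in_unlabeled_algebra)
  obtain G where G: "of_graph edge_graph ^ k = of_graph G" "nedges G = k" "nverts G = 2 * k"
    using edge_power_graph by blast
  \<comment> \<open>Here \<open>k + 1 < 2 * k\<close>, by \<open>k \<ge> 3\<close>.\<close>
  have "G \<noteq> path_graph k" using G(3) nverts_path_graph[of k] assms(1) by auto
  then show "\<not> sos (c *\<^sub>R of_graph (path_graph k) - of_graph edge_graph ^ k)"
    unfolding G(1) using triv G(2) by (intro not_sos_trivial_square) (simp_all add: nedges_path_graph)
qed

end
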